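(* Let $d_1,d_2\ge 1$ be integers, let $\mu>-\tfrac12$ and let $\boldsymbol{\kappa}=(\kappa_1,\dots,\kappa_{d_2})\in\mathbb{R}^{d_2}$ with $\kappa_i>-1$ for $1\le i\le d_2$. Define the second-order differential operator $$ \mathfrak{D}_{\mu,\boldsymbol\kappa}^{\mathbb{B}\rtimes\triangle}u:=(1-|y|)\Delta_x u-\big(\langle x,\nabla_x\rangle+\langle y,\nabla_y\rangle\big)^2u+\sum_{i=1}^{d_2}\big(y_i\partial_{y_i}^2+(\kappa_i+1)\partial_{y_i}\big)u-(|\boldsymbol\kappa|+2\mu+d_1+d_2-1)\big(\langle x,\nabla_x\rangle+\langle y,\nabla_y\rangle\big)u . $$ Then, for each $n\in\mathbb{N}_0$, $\mathcal{V}_n\big(\mathbb{B}^{d_1}\rtimes\triangle^{d_2},W_{\mu,\boldsymbol\kappa}^{\mathbb{B}\rtimes\triangle}\big)$ is an eigenspace of $\mathfrak{D}_{\mu,\boldsymbol\kappa}^{\mathbb{B}\rtimes\triangle}$; more precisely, $$ \mathfrak{D}_{\mu,\boldsymbol\kappa}^{\mathbb{B}\rtimes\triangle}u=-n\big(n+|\boldsymbol\kappa|+2\mu+d_1+d_2-1\big)u\qquad\text{for all }u\in\mathcal{V}_n\big(\mathbb{B}^{d_1}\rtimes\triangle^{d_2},W_{\mu,\boldsymbol\kappa}^{\mathbb{B}\rtimes\triangle}\big). $$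
   Context: Variables are $(x,y)\in\mathbb{R}^{d_1}\times\mathbb{R}^{d_2}$; $\|x\|$ is the Euclidean norm, $|y|=y_1+\dots+y_{d_2}$, $|\boldsymbol\kappa|=\kappa_1+\dots+\kappa_{d_2}$. $\Delta_x$ is the Laplacian in $x$, $\langle x,\nabla_x\rangle=\sum_i x_i\partial_{x_i}$, $\langle y,\nabla_y\rangle=\sum_i y_i\partial_{y_i}$, and powers of operators mean composition. The simplex is $\triangle^{d}=\{y\in\mathbb{R}^d:y_1\ge0,\dots,y_d\ge0,\ |y|\le1\}$. The domain is $\mathbb{B}^{d_1}\rtimes\triangle^{d_2}=\{(x,y)\in\mathbb{R}^{d_1}\times\triangle^{d_2}:\|x\|\le1-|y|\}$ and the weight on it is $W_{\mu,\boldsymbol\kappa}^{\mathbb{B}\rtimes\triangle}(x,y)=\prod_{i=1}^{d_2}y_i^{\kappa_i}\,\big[(1-|y|)^2-\|x\|^2\big]^{\mu-\frac12}$. For a weight $W$ on a domain $\Omega$, $\mathcal{V}_n(\Omega,W)$ is the space of real polynomials of degree $n$ (together with $0$) that are orthogonal to all polynomials of degree less than $n$ with respect to $\int_\Omega fg\,W$. *)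

theory Defs
  imports "HOL-Analysis.Analysis"
begin

definition monom_fun :: "('a::euclidean_space \<Rightarrow> nat) \<Rightarrow> 'a \<Rightarrow> real" where
  "monom_fun \<alpha> p = (\<Prod>b\<in>Basis. (p \<bullet> b) ^ \<alpha> b)"

text \<open>
  Multi-indices are exponent functions on \<^term>\<open>Basis\<close>, made extensional
  so that the index set of the sum in \<open>polys_upto\<close> below is finite.
\<close>

definition multi_indices_upto :: "nat \<Rightarrow> ('a::euclidean_space \<Rightarrow> nat) set" where
  "multi_indices_upto n = {\<alpha> \<in> Basis \<rightarrow>\<^sub>E UNIV. (\<Sum>b\<in>Basis. \<alpha> b) \<le> n}"

lemma finite_multi_indices_upto: "finite (multi_indices_upto n :: ('a::euclidean_space \<Rightarrow> nat) set)"
proof -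
  have "(multi_indices_upto n :: ('a \<Rightarrow> nat) set) \<subseteq> Basis \<rightarrow>\<^sub>E {..n}"
  proof
    fix \<alpha> :: "'a \<Rightarrow> nat" assume a: "\<alpha> \<in> multi_indices_upto n"
    have "\<alpha> b \<le> n" if "b \<in> Basis" for b
      using member_le_sum[OF that, of \<alpha>] a by (auto simp: multi_indices_upto_def)
    with a show "\<alpha> \<in> Basis \<rightarrow>\<^sub>E {..n}"
      by (auto simp: multi_indices_upto_def PiE_iff)
  qed
  then show ?thesis by (rule finite_subset) (intro finite_PiE finite_Basis finite_atMost)
qed

definition polys_upto :: "nat \<Rightarrow> ('a::euclidean_space \<Rightarrow> real) set" where
  "polys_upto n = {f. \<exists>c. f = (\<lambda>p. \<Sum>\<alpha>\<in>multi_indices_upto n. c \<alpha> * monom_fun \<alpha> p)}"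

text \<open>
  The total degree of a polynomial function; the zero polynomial gets degree 0.
  Every \<^const>\<open>real_polynomial_function\<close> lies in some \<open>polys_upto n\<close>
  (lemma \<open>real_polynomial_function_iff\<close>), so the minimum exists.
\<close>

definition total_degree :: "('a::euclidean_space \<Rightarrow> real) \<Rightarrow> nat" where
  "total_degree f = (LEAST n. f \<in> polys_upto n)"

definition orth_polys :: "'a::euclidean_space set \<Rightarrow> ('a \<Rightarrow> real) \<Rightarrow> nat \<Rightarrow> ('a \<Rightarrow> real) set" where
  "orth_polys \<Omega> W n =
     {u. real_polynomial_function u \<and> (u = (\<lambda>_. 0) \<or> total_degree u = n) \<and>
         (\<forall>g. real_polynomial_function g \<and> total_degree g < n \<longrightarrow>
              (LINT p:\<Omega>|lborel. u p * g p * W p) = 0)}"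

lemma polys_upto_0: "(\<lambda>_. 0) \<in> polys_upto n"
  unfolding polys_upto_def by (auto intro!: exI[of _ "\<lambda>_. 0"])

lemma polys_upto_add:
  assumes "f \<in> polys_upto n" "g \<in> polys_upto n"
  shows "(\<lambda>p. f p + g p) \<in> polys_upto n"
proof -
  from assms obtain c d where
    "f = (\<lambda>p. \<Sum>\<alpha>\<in>multi_indices_upto n. c \<alpha> * monom_fun \<alpha> p)"
    "g = (\<lambda>p. \<Sum>\<alpha>\<in>multi_indices_upto n. d \<alpha> * monom_fun \<alpha> p)"
    unfolding polys_upto_def by auto
  then show ?thesis unfolding polys_upto_def
    by (auto intro!: exI[of _ "\<lambda>\<alpha>. c \<alpha> + d \<alpha>"] simp: algebra_simps sum.distrib)
qed

lemma polys_upto_sum: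
  assumes "finite A" "\<And>i. i \<in> A \<Longrightarrow> f i \<in> polys_upto n"
  shows "(\<lambda>p. \<Sum>i\<in>A. f i p) \<in> polys_upto n"
  using assms by (induction A rule: finite_induct) (auto intro: polys_upto_0 polys_upto_add)

lemma polys_upto_cmult_monom:
  assumes "(\<Sum>b\<in>Basis. \<alpha> b) \<le> n"
  shows "(\<lambda>p. c * monom_fun \<alpha> p) \<in> polys_upto n"
proof -
  let ?\<beta> = "restrict \<alpha> Basis"
  have b: "?\<beta> \<in> multi_indices_upto n"
    using assms by (auto simp: multi_indices_upto_def)
  have m: "monom_fun \<alpha> = monom_fun ?\<beta>"
    by (auto simp: monom_fun_def fun_eq_iff)
  have "(\<lambda>p. c * monom_fun \<alpha> p) =
      (\<lambda>p. \<Sum>\<gamma>\<in>multi_indices_upto n. (if \<gamma> = ?\<beta> then c else 0) * monom_fun \<gamma> p)"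
    using b unfolding m
    by (simp add: if_distrib[of "\<lambda>t. t * _"] sum.delta finite_multi_indices_upto cong: if_cong)
  then show ?thesis unfolding polys_upto_def
    by (intro CollectI exI[of _ "\<lambda>\<gamma>. if \<gamma> = ?\<beta> then c else 0"])
qed

lemma real_polynomial_function_iff:
  "real_polynomial_function f \<longleftrightarrow> (\<exists>n. f \<in> polys_upto n)"
proof
  assume "real_polynomial_function f"
  then show "\<exists>n. f \<in> polys_upto n"
  proof induction
    case (linear f)
    then interpret bounded_linear f .
    have "(\<lambda>p. f b * monom_fun (\<lambda>b'. if b' = b then 1 else 0) p) \<in> polys_upto 1"
      if "b \<in> Basis" for b
      by (rule polys_upto_cmult_monom) (use that in simp)
    then have "(\<lambda>p. \<Sum>b\<in>Basis. f b * monom_fun (\<lambda>b'. if b' = b then 1 else 0) p)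
        \<in> polys_upto 1"
      by (intro polys_upto_sum) auto
    moreover have "f p = (\<Sum>b\<in>Basis. f b * monom_fun (\<lambda>b'. if b' = b then 1 else 0) p)" for p
    proof -
      have "f p = f (\<Sum>b\<in>Basis. (p \<bullet> b) *\<^sub>R b)" by (simp add: euclidean_representation)
      also have "\<dots> = (\<Sum>b\<in>Basis. (p \<bullet> b) * f b)" by (simp add: sum scaleR)
      also have "\<dots> = (\<Sum>b\<in>Basis. f b * monom_fun (\<lambda>b'. if b' = b then 1 else 0) p)"
      proof (rule sum.cong)
        fix b :: 'a assume b: "b \<in> Basis"
        have "monom_fun (\<lambda>b'. if b' = b then 1 else 0) p =
            (\<Prod>b'\<in>Basis. if b' = b then p \<bullet> b' else 1)"
          unfolding monom_fun_def by (intro prod.cong) auto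
        with b show "p \<bullet> b * f b = f b * monom_fun (\<lambda>b'. if b' = b then 1 else 0) p" by simp
      qed simp
      finally show ?thesis .
    qed
    ultimately show ?case by (metis (no_types, lifting) ext)
  next
    case (const c)
    have "(\<lambda>p. c * monom_fun (\<lambda>_. 0) p) \<in> polys_upto 0"
      by (rule polys_upto_cmult_monom) simp
    then show ?case by (auto simp: monom_fun_def)
  next
    case (add f g)
    have mono: "h \<in> polys_upto (max m n)" if "h \<in> polys_upto m" for h :: "'a \<Rightarrow> real" and m n
    proof -
      from that obtain c where "h = (\<lambda>p. \<Sum>\<alpha>\<in>multi_indices_upto m. c \<alpha> * monom_fun \<alpha> p)"
        unfolding polys_upto_def by auto
      moreover have "(\<Sum>b\<in>Basis. \<alpha> b) \<le> max m n" if "\<alpha> \<in> multi_indices_upto m" for \<alpha> :: "'a \<Rightarrow> nat"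
        using that by (auto simp: multi_indices_upto_def)
      ultimately show ?thesis
        by (simp add: polys_upto_sum polys_upto_cmult_monom finite_multi_indices_upto)
    qed
    from add obtain m n where "f \<in> polys_upto m" "g \<in> polys_upto n" by auto
    then have "f \<in> polys_upto (max m n)" "g \<in> polys_upto (max m n)"
      using mono[of f m n] mono[of g n m] by (auto simp: max.commute)
    then show ?case using polys_upto_add by blast
  next
    case (mult f g)
    then obtain m n c d where
      f: "f = (\<lambda>p. \<Sum>\<alpha>\<in>multi_indices_upto m. c \<alpha> * monom_fun \<alpha> p)" and
      g: "g = (\<lambda>p. \<Sum>\<beta>\<in>multi_indices_upto n. d \<beta> * monom_fun \<beta> p)"
      unfolding polys_upto_def by auto
    have mm: "monom_fun \<alpha> p * monom_fun \<beta> p = monom_fun (\<lambda>b. \<alpha> b + \<beta> b) p"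
      for \<alpha> \<beta> and p :: 'a
      by (simp add: monom_fun_def power_add prod.distrib)
    have "(\<lambda>p. f p * g p) = (\<lambda>p. \<Sum>\<alpha>\<in>multi_indices_upto m. \<Sum>\<beta>\<in>multi_indices_upto n.
        (c \<alpha> * d \<beta>) * monom_fun (\<lambda>b. \<alpha> b + \<beta> b) p)"
      unfolding f g sum_product mm[symmetric] by (simp add: mult_ac)
    also have "\<dots> \<in> polys_upto (m + n)"
      by (intro polys_upto_sum polys_upto_cmult_monom finite_multi_indices_upto)
         (auto simp: multi_indices_upto_def sum.distrib intro: add_mono)
    finally show ?case by blast
  qed
next
  assume "\<exists>n. f \<in> polys_upto n"
  then obtain n c where f: "f = (\<lambda>p. \<Sum>\<alpha>\<in>multi_indices_upto n. c \<alpha> * monom_fun \<alpha> p)"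
    unfolding polys_upto_def by auto
  have "real_polynomial_function (\<lambda>p. p \<bullet> b)" for b :: 'a
    by (intro real_polynomial_function.intros(1) bounded_linear_inner_left)
  then show "real_polynomial_function f"
    unfolding f monom_fun_def
    by (intro real_polynomial_function_sum real_polynomial_function_prod
              real_polynomial_function.intros(4) real_polynomial_function_power
              real_polynomial_function.intros(2) finite_multi_indices_upto finite_Basis) auto
qed

definition dir_deriv :: "'a::real_vector \<Rightarrow> ('a \<Rightarrow> real) \<Rightarrow> 'a \<Rightarrow> real" where
  "dir_deriv v u p = deriv (\<lambda>t. u (p + t *\<^sub>R v)) 0"

definition dx :: "'m \<Rightarrow> ((real^'m) \<times> (real^'n) \<Rightarrow> real) \<Rightarrow> (real^'m) \<times> (real^'n) \<Rightarrow> real" where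
  "dx i = dir_deriv (axis i 1, 0)"

definition dy :: "'n \<Rightarrow> ((real^'m) \<times> (real^'n) \<Rightarrow> real) \<Rightarrow> (real^'m) \<times> (real^'n) \<Rightarrow> real" where
  "dy j = dir_deriv (0, axis j 1)"

definition laplace_x :: "((real^'m) \<times> (real^'n) \<Rightarrow> real) \<Rightarrow> (real^'m) \<times> (real^'n) \<Rightarrow> real" where
  "laplace_x u p = (\<Sum>i\<in>UNIV. ((dx i) ^^ 2) u p)"

definition euler_op :: "((real^'m) \<times> (real^'n) \<Rightarrow> real) \<Rightarrow> (real^'m) \<times> (real^'n) \<Rightarrow> real" where
  "euler_op u = (\<lambda>(x, y). (\<Sum>i\<in>UNIV. x $ i * dx i u (x, y)) + (\<Sum>j\<in>UNIV. y $ j * dy j u (x, y)))"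

definition csum :: "real^'n \<Rightarrow> real" where
  "csum y = (\<Sum>j\<in>UNIV. y $ j)"

definition std_simplex :: "(real^'n) set" where
  "std_simplex = {y. (\<forall>j. 0 \<le> y $ j) \<and> csum y \<le> 1}"

definition ball_simplex :: "((real^'m) \<times> (real^'n)) set" where
  "ball_simplex = {(x, y). y \<in> std_simplex \<and> norm x \<le> 1 - csum y}"

definition weight_BT :: "real \<Rightarrow> real^'n \<Rightarrow> (real^'m) \<times> (real^'n) \<Rightarrow> real" where
  "weight_BT \<mu> \<kappa> = (\<lambda>(x, y).
     (\<Prod>j\<in>UNIV. y $ j powr \<kappa> $ j) * ((1 - csum y)\<^sup>2 - (norm x)\<^sup>2) powr (\<mu> - 1/2))"

definition diff_op_BT :: "real \<Rightarrow> real^'n \<Rightarrow> ((real^'m) \<times> (real^'n) \<Rightarrow> real)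
    \<Rightarrow> (real^'m) \<times> (real^'n) \<Rightarrow> real" where
  "diff_op_BT \<mu> \<kappa> u = (\<lambda>(x, y).
     (1 - csum y) * laplace_x u (x, y)
     - (euler_op ^^ 2) u (x, y)
     + (\<Sum>j\<in>UNIV. y $ j * ((dy j) ^^ 2) u (x, y) + (\<kappa> $ j + 1) * dy j u (x, y))
     - (csum \<kappa> + 2 * \<mu> + real CARD('m) + real CARD('n) - 1) * euler_op u (x, y))"

end

theory Submission
  imports Defs "HOL-Real_Asymp.Real_Asymp"
begin

text \<open>
  Write \<open>W\<close> for the weight, \<open>D\<close> for the operator, \<open>E\<close> for the Euler operator, \<open>z = (x, y)\<close> and
  \<open>A = |\<kappa>| + 2 \<mu> + d_1 + d_2 - 1\<close>. The theorem rests on two properties of \<open>D\<close>.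

  First, \<open>D\<close> does not raise degrees, and on the part of top degree \<open>n\<close> it is multiplication by
  \<open>- n (n + A)\<close>. This is Euler's identity (lemma \<open>diff_op_BT_leading_part\<close>).

  Second, \<open>D\<close> is symmetric on polynomials for the inner product given by \<open>W\<close> (lemma
  \<open>diff_op_BT_symmetric\<close>). Indeed \<open>W D u = div (W M grad u)\<close> for the symmetric matrix \<open>M\<close> with
  \<open>M grad u = ((1 - |y|) grad_x u - (E u) x, y * grad_y u - (E u) y)\<close>, where \<open>*\<close> is taken
  coordinatewise, and \<open>M grad u\<close> is tangent to all parts of the boundary, so that integration by
  parts leaves no boundary terms. Tangency and the divergence form come from one fact (lemma \<open>sum_flux_log_grad\<close>): the
  product of \<open>M grad u\<close> with the gradient of \<open>log W\<close> is a polynomial, although \<open>log W\<close> is singular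
  at the boundary.

  Given these, let \<open>u\<close> have degree \<open>n\<close> and be orthogonal to lower degrees. Then
  \<open>v = D u + n (n + A) u\<close> has degree less than \<open>n\<close>, and
  \<open>\<langle>v, v\<rangle> = \<langle>D u, v\<rangle> + n (n + A) \<langle>u, v\<rangle> = \<langle>u, D v\<rangle> + 0 = 0\<close>, so that \<open>v = 0\<close>.

  The analytic work is due to the weight, which is unbounded when exponents are negative, and to the
  corners of the domain. The divergence theorem (lemma \<open>integral_divergence_tangential_eq_0\<close>) is
  therefore proved by cutting off near the zeros of a boundary function; tangency keeps
  the error term bounded and makes it vanish in the limit. The cut-off fields have compact support and
  are handled by translation invariance of Lebesgue measure. Integrability of \<open>W\<close> (lemma
  \<open>set_integrable_weight_BT\<close>), without which the inner product would carry no information, follows by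
  averaging over dilations.
\<close>

section \<open>Integrals of directional derivatives\<close>

lemma lborel_integrable_translate:
  fixes g :: "'a::euclidean_space \<Rightarrow> real"
  assumes "integrable lborel g"
  shows "integrable lborel (\<lambda>p. g (p + c))"
proof -
  have "integrable (distr lborel borel ((+) c)) g"
    unfolding lborel_distr_plus by (fact assms)
  then show ?thesis
    by (subst (asm) integrable_distr_eq) (use assms in \<open>auto simp: add.commute\<close>)
qed

lemma lborel_integral_translate:
  fixes g :: "'a::euclidean_space \<Rightarrow> real"
  assumes [measurable]: "g \<in> borel_measurable borel"
  shows "(LINT p|lborel. g (p + c)) = (LINT p|lborel. g p)"
proof -
  have "(LINT p|lborel. g p) = (LINT p|distr lborel borel ((+) c). g p)"
    unfolding lborel_distr_plus ..
  also have "\<dots> = (LINT p|lborel. g (c + p))"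
    by (rule integral_distr) auto
  finally show ?thesis by (simp add: add.commute)
qed

text \<open>
  Averaging \<open>g\<close> over the segment from \<open>p\<close> to \<open>p + v\<close> gives \<open>G (p + v) - G p\<close>. Translation
  invariance makes the average have the same integral as \<open>g\<close>, and the difference have integral
  zero.
\<close>
lemma integral_directional_derivative_eq_0:
  fixes G g :: "'a::euclidean_space \<Rightarrow> real"
  assumes G: "integrable lborel G" and g: "integrable lborel g"
    and deriv: "\<And>p. ((\<lambda>t. G (p + t *\<^sub>R v)) has_real_derivative g p) (at 0)"
  shows "(LINT p|lborel. g p) = 0"
proof -
  have [measurable]: "g \<in> borel_measurable borel" "G \<in> borel_measurable borel"
    using g G by auto
  define f where "f = (\<lambda>(t::real, p). indicator {0..1} t * g (p + t *\<^sub>R v))"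
  have fm: "f \<in> borel_measurable (lborel \<Otimes>\<^sub>M lborel)"
    unfolding f_def by measurable
  have slice: "integrable lborel (\<lambda>p. f (t, p))" for t
    unfolding f_def by (auto intro!: lborel_integrable_translate g)
  have f_int: "integrable (lborel \<Otimes>\<^sub>M lborel) f"
  proof (rule lborel_pair.Fubini_integrable[OF fm])
    have "(LINT p|lborel. norm (f (t, p))) = indicator {0..1} t * (LINT p|lborel. \<bar>g p\<bar>)" for t
      using lborel_integral_translate[of "\<lambda>p. \<bar>g p\<bar>" "t *\<^sub>R v"]
      by (simp add: f_def abs_mult)
    then show "integrable lborel (\<lambda>t. LINT p|lborel. norm (f (t, p)))"
      by simp
  qed (use slice in auto)
  have along: "((\<lambda>t. g (p + t *\<^sub>R v)) has_integral (G (p + v) - G p)) {0..1}" for p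
  proof -
    have "((\<lambda>t. G (p + t *\<^sub>R v)) has_real_derivative g (p + s *\<^sub>R v)) (at s)" for s
      using DERIV_shift[of "\<lambda>t. G (p + t *\<^sub>R v)" "g (p + s *\<^sub>R v)" 0 s] deriv[of "p + s *\<^sub>R v"]
      by (simp add: algebra_simps)
    then have "((\<lambda>t. g (p + t *\<^sub>R v)) has_integral (G (p + 1 *\<^sub>R v) - G (p + 0 *\<^sub>R v))) {0..1}"
      by (intro fundamental_theorem_of_calculus)
         (auto simp: has_real_derivative_iff_has_vector_derivative[symmetric]
               intro: has_field_derivative_at_within)
    then show ?thesis by simp
  qed
  have "AE p in lborel. integrable lborel (\<lambda>t. f (t, p))"
    using lborel_pair.AE_integrable_snd[of "\<lambda>t p. f (t, p)"] f_int by simp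
  \<comment> \<open>Fubini provides integrability along almost every line only, which is where the fundamental theorem of calculus may be read as a Lebesgue integral.\<close>
  then have ae: "AE p in lborel. (LINT t|lborel. f (t, p)) = G (p + v) - G p"
  proof eventually_elim
    case (elim p)
    then have "set_integrable lborel {0..1} (\<lambda>t. g (p + t *\<^sub>R v))"
      by (simp add: f_def set_integrable_def)
    from set_borel_integral_eq_integral(2)[OF this] along[of p]
    show ?case by (simp add: f_def set_lebesgue_integral_def integral_unique)
  qed
  have "(LINT p|lborel. g p) = (LINT t|lborel. indicator {0..1} (t::real) * (LINT p|lborel. g p))"
    by simp
  also have "\<dots> = (LINT t|lborel. (LINT p|lborel. f (t, p)))"
    by (simp add: f_def lborel_integral_translate)
  also have "\<dots> = (LINT p|lborel. (LINT t|lborel. f (t, p)))"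
    using lborel_pair.Fubini_integral[of "\<lambda>t p. f (t, p)"] f_int by simp
  also have "\<dots> = (LINT p|lborel. G (p + v) - G p)"
    by (rule integral_cong_AE) (use ae fm in auto)
  also have "\<dots> = 0"
    using G by (simp add: lborel_integrable_translate lborel_integral_translate)
  finally show ?thesis .
qed

text \<open>
  A continuously differentiable function that vanishes on \<open>t \<le> 1\<close> and tends to 1 at infinity. What
  matters is its scale-invariant derivative \<open>t * cutoff' t\<close>, which is bounded and tends to 0: it
  is the factor that appears when \<open>cutoff (k * \<rho>)\<close> is differentiated along a field under which the
  logarithm of \<open>\<rho>\<close> has a bounded derivative.
\<close>
definition cutoff :: "real \<Rightarrow> real" where
  "cutoff t = (max 0 (t - 1))\<^sup>2 / (1 + (max 0 (t - 1))\<^sup>2)"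

definition cutoff_deriv :: "real \<Rightarrow> real" where
  "cutoff_deriv t = 2 * max 0 (t - 1) / (1 + (max 0 (t - 1))\<^sup>2)\<^sup>2"

lemma cutoff_has_derivative: "(cutoff has_real_derivative cutoff_deriv t) (at t)"
proof -
  have sq: "((\<lambda>t. (max 0 (t - 1))\<^sup>2) has_real_derivative 2 * max 0 (t - 1)) (at t)" for t :: real
  proof -
    consider "t < 1" | "t > 1" | "t = 1" by linarith
    then show ?thesis
    proof cases
      case 1
      have "((\<lambda>t::real. 0) has_real_derivative 2 * max 0 (t - 1)) (at t)"
        using 1 by simp
      then show ?thesis
        by (rule has_field_derivative_transform_within_open[where S = "{..<1}"]) (use 1 in auto)
    next
      case 2
      have "((\<lambda>t. (t - 1)\<^sup>2) has_real_derivative 2 * max 0 (t - 1)) (at t)"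
        using 2 by (auto intro!: derivative_eq_intros)
      then show ?thesis
        by (rule has_field_derivative_transform_within_open[where S = "{1<..}"]) (use 2 in auto)
    next
      case 3
      \<comment> \<open>The two branches meet here, so the difference quotient is estimated directly.\<close>
      have "((\<lambda>h. (max 0 h)\<^sup>2 / h) \<longlongrightarrow> 0) (at (0::real))"
      proof (rule Lim_null_comparison)
        have "norm ((max 0 h)\<^sup>2 / h) \<le> \<bar>h\<bar>" for h :: real
          by (auto simp: max_def power2_eq_square)
        then show "\<forall>\<^sub>F h in at 0. norm ((max 0 h)\<^sup>2 / h) \<le> \<bar>h::real\<bar>" by simp
      qed (auto intro!: tendsto_eq_intros)
      with 3 show ?thesis by (simp add: DERIV_def)
    qed
  qed
  have "1 + (max 0 (t - 1))\<^sup>2 \<noteq> 0" using zero_le_power2[of "max 0 (t - 1)"] by linarith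
  from DERIV_divide[OF sq DERIV_add[OF DERIV_const sq] this]
  show ?thesis
    unfolding cutoff_def[abs_def] cutoff_deriv_def
    by (rule DERIV_cong) (simp add: power2_eq_square algebra_simps)
qed

lemma cutoff_bounds: "0 \<le> cutoff t" "cutoff t \<le> 1"
proof -
  have "0 < 1 + (max 0 (t - 1))\<^sup>2" by (rule add_pos_nonneg) auto
  then show "0 \<le> cutoff t" "cutoff t \<le> 1" by (simp_all add: cutoff_def)
qed

lemma cutoff_deriv_bounds:
  assumes "t \<ge> 0"
  shows "0 \<le> t * cutoff_deriv t" "t * cutoff_deriv t \<le> 4"
    "t > 2 \<Longrightarrow> t * cutoff_deriv t \<le> 4 / (t - 1)\<^sup>2"
proof -
  show "0 \<le> t * cutoff_deriv t" using assms by (simp add: cutoff_deriv_def)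
  define s where "s = max 0 (t - 1)"
  have s: "s \<ge> 0" "t \<le> 1 + s" by (auto simp: s_def)
  have q: "1 + s\<^sup>2 \<ge> 1" by simp
  have "t * (2 * s) \<le> (1 + s) * (2 * s)" using s by (intro mult_right_mono) auto
  also have "\<dots> \<le> (1 + s) * (2 * s) + (s - 1)\<^sup>2 + s\<^sup>2 + 3" by simp
  also have "\<dots> = 4 * (1 + s\<^sup>2)" by (simp add: power2_eq_square algebra_simps)
  finally have 1: "t * (2 * s) \<le> 4 * (1 + s\<^sup>2)" .
  then have 2: "t * cutoff_deriv t \<le> 4 / (1 + s\<^sup>2)"
  proof -
    have "t * cutoff_deriv t = t * (2 * s) / (1 + s\<^sup>2)\<^sup>2"
      by (simp add: cutoff_deriv_def s_def)
    also have "\<dots> \<le> 4 * (1 + s\<^sup>2) / (1 + s\<^sup>2)\<^sup>2"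
      using 1 by (rule divide_right_mono) (rule zero_le_power2)
    also have "\<dots> = 4 / (1 + s\<^sup>2)"
    proof -
      have "4 * r / r\<^sup>2 = 4 / r" if "r \<ge> 1" for r :: real
        using that by (simp add: power2_eq_square)
      from this[OF q] show ?thesis .
    qed
    finally show ?thesis .
  qed
  also have "\<dots> \<le> 4"
  proof -
    have "4 / r \<le> 4" if "r \<ge> 1" for r :: real
      using that by (simp add: divide_simps)
    from this[OF q] show ?thesis .
  qed
  finally show "t * cutoff_deriv t \<le> 4" .
  show "t * cutoff_deriv t \<le> 4 / (t - 1)\<^sup>2" if "t > 2"
    using 2 that by (intro order.trans[OF 2] divide_left_mono mult_pos_pos add_pos_nonneg)
      (auto simp: s_def)
qed

lemma cutoff_limits:
  fixes r :: real
  assumes "r > 0"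
  shows "(\<lambda>k. cutoff (real (Suc k) * r)) \<longlonglongrightarrow> 1"
    and "(\<lambda>k. real (Suc k) * r * cutoff_deriv (real (Suc k) * r)) \<longlonglongrightarrow> 0"
proof -
  have top: "filterlim (\<lambda>k. r * real (Suc k)) at_top sequentially"
    by (rule filterlim_tendsto_pos_mult_at_top[OF tendsto_const assms])
       (rule filterlim_compose[OF filterlim_real_sequentially filterlim_Suc])
  have inv: "(\<lambda>k. c / (r * real (Suc k) - 1)\<^sup>2) \<longlonglongrightarrow> 0" for c :: real
    using assms by real_asymp
  have big: "\<forall>\<^sub>F k in sequentially. r * real (Suc k) > 2"
    using top by (simp add: filterlim_at_top_dense)
  show "(\<lambda>k. cutoff (real (Suc k) * r)) \<longlonglongrightarrow> 1"
  proof -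
    have "(\<lambda>k. 1 - 1 / (1 + (max 0 (r * real (Suc k) - 1))\<^sup>2)) \<longlonglongrightarrow> 1 - 0"
    proof (intro tendsto_diff tendsto_const Lim_null_comparison[OF _ inv[of 1]])
      show "\<forall>\<^sub>F k in sequentially. norm (1 / (1 + (max 0 (r * real (Suc k) - 1))\<^sup>2))
          \<le> 1 / (r * real (Suc k) - 1)\<^sup>2"
        using big by eventually_elim (auto intro!: divide_left_mono mult_pos_pos add_pos_nonneg simp: max_def)
    qed
    moreover have "1 - 1 / (1 + (max 0 (t - 1))\<^sup>2) = cutoff t" for t :: real
    proof -
      have "0 < 1 + (max 0 (t - 1))\<^sup>2" by (rule add_pos_nonneg) auto
      then show ?thesis by (simp add: cutoff_def divide_simps)
    qed
    ultimately show ?thesis by (simp add: mult.commute)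
  qed
  show "(\<lambda>k. real (Suc k) * r * cutoff_deriv (real (Suc k) * r)) \<longlonglongrightarrow> 0"
  proof (rule Lim_null_comparison[OF _ inv[of 4]])
    show "\<forall>\<^sub>F k in sequentially. norm (real (Suc k) * r * cutoff_deriv (real (Suc k) * r))
        \<le> 4 / (r * real (Suc k) - 1)\<^sup>2"
      using big
    proof eventually_elim
      case (elim k)
      with cutoff_deriv_bounds[of "real (Suc k) * r"] assms show ?case
        by (simp add: mult.commute)
    qed
  qed
qed

section \<open>Divergence theorem for fields tangent to the boundary\<close>

text \<open>
  Here \<open>G\<close> is a vector field with components along the directions \<open>v i\<close>, and \<open>H\<close> is its divergence.
  Tangency is expressed by a boundary function \<open>\<rho>\<close>, positive inside and tending to zero at the
  boundary: the derivative of \<open>\<rho>\<close> along \<open>G\<close> is \<open>O(\<rho>)\<close>. The field \<open>cutoff (k \<rho>) G\<close> has compact support, so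
  its divergence \<open>cutoff (k \<rho>) H + k cutoff' (k \<rho>) (G \<cdot> grad \<rho>)\<close> integrates to zero. The second term is
  at most \<open>C\<close> times \<open>k \<rho> cutoff' (k \<rho>)\<close>, hence disappears in the limit by dominated convergence.
\<close>
lemma integral_divergence_tangential_eq_0:
  fixes U :: "'a::euclidean_space set" and \<rho> H C :: "'a \<Rightarrow> real"
    and v :: "'i \<Rightarrow> 'a" and G dG d\<rho> :: "'i \<Rightarrow> 'a \<Rightarrow> real"
  assumes "open U" and fin: "finite I"
    and compact: "\<And>\<epsilon>. \<epsilon> > 0 \<Longrightarrow> compact {p\<in>U. \<epsilon> \<le> \<rho> p}"
    and pos: "\<And>p. p \<in> U \<Longrightarrow> \<rho> p > 0"
    and \<rho>_cont: "continuous_on U \<rho>"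
    and \<rho>_deriv: "\<And>i p. i \<in> I \<Longrightarrow> p \<in> U \<Longrightarrow>
        ((\<lambda>t. \<rho> (p + t *\<^sub>R v i)) has_real_derivative d\<rho> i p) (at 0)"
    and d\<rho>_cont: "\<And>i. i \<in> I \<Longrightarrow> continuous_on U (d\<rho> i)"
    and G_deriv: "\<And>i p. i \<in> I \<Longrightarrow> p \<in> U \<Longrightarrow>
        ((\<lambda>t. G i (p + t *\<^sub>R v i)) has_real_derivative dG i p) (at 0)"
    and G_cont: "\<And>i. i \<in> I \<Longrightarrow> continuous_on U (G i)"
    and dG_cont: "\<And>i. i \<in> I \<Longrightarrow> continuous_on U (dG i)"
    and div: "\<And>p. p \<in> U \<Longrightarrow> (\<Sum>i\<in>I. dG i p) = H p"
    and tangent: "\<And>p. p \<in> U \<Longrightarrow> \<bar>\<Sum>i\<in>I. G i p * d\<rho> i p\<bar> \<le> C p * \<rho> p"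
    and H_int: "set_integrable lborel U H" and C_int: "set_integrable lborel U C"
  shows "(LINT p:U|lborel. H p) = 0"
proof -
  define K where "K = (\<lambda>k. {p\<in>U. 1 / real (Suc k) \<le> \<rho> p})"
  define F where "F = (\<lambda>k i p. indicator (K k) p * (cutoff (real (Suc k) * \<rho> p) * G i p))"
  define dF where "dF = (\<lambda>k i p. indicator (K k) p *
    (real (Suc k) * cutoff_deriv (real (Suc k) * \<rho> p) * d\<rho> i p * G i p
      + cutoff (real (Suc k) * \<rho> p) * dG i p))"
  define h where "h = (\<lambda>k p. \<Sum>i\<in>I. dF k i p)"
  have cK: "compact (K k)" for k unfolding K_def by (rule compact) auto
  have KU: "K k \<subseteq> U" for k by (auto simp: K_def)
  have cutoff0: "cutoff (real (Suc k) * \<rho> p) = 0" "cutoff_deriv (real (Suc k) * \<rho> p) = 0"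
    if "p \<in> U" "p \<notin> K k" for k p
    using that by (auto simp: K_def cutoff_def cutoff_deriv_def field_simps)
  have F_U: "F k i p = cutoff (real (Suc k) * \<rho> p) * G i p" if "p \<in> U" for k i p
    using that cutoff0[of p k] by (cases "p \<in> K k") (auto simp: F_def)
  have dF_U: "dF k i p = real (Suc k) * cutoff_deriv (real (Suc k) * \<rho> p) * d\<rho> i p * G i p
      + cutoff (real (Suc k) * \<rho> p) * dG i p" if "p \<in> U" for k i p
    using that cutoff0[of p k] by (cases "p \<in> K k") (auto simp: dF_def)
  have cutoff_cont: "continuous_on UNIV cutoff"
    using cutoff_has_derivative by (intro DERIV_continuous_on) (auto intro: has_field_derivative_at_within)
  have cutoff_deriv_cont: "continuous_on UNIV cutoff_deriv"
  proof -
    have "1 + (max 0 (t - 1))\<^sup>2 \<noteq> 0" for t :: real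
      using zero_le_power2[of "max 0 (t - 1)"] by linarith
    then show ?thesis unfolding cutoff_deriv_def by (auto intro!: continuous_intros)
  qed
  note cuts = continuous_on_compose2[OF cutoff_cont] continuous_on_compose2[OF cutoff_deriv_cont]
  have F_int: "integrable lborel (F k i)" and dF_int: "integrable lborel (dF k i)"
    if "i \<in> I" for k i
  proof -
    note cont = G_cont[OF that, THEN continuous_on_subset, OF KU]
      dG_cont[OF that, THEN continuous_on_subset, OF KU]
      d\<rho>_cont[OF that, THEN continuous_on_subset, OF KU]
      \<rho>_cont[THEN continuous_on_subset, OF KU]
    have "integrable lborel (\<lambda>p. indicator (K k) p *\<^sub>R (cutoff (real (Suc k) * \<rho> p) * G i p))"
      by (rule borel_integrable_compact[OF cK]) (intro continuous_intros cuts cont subset_UNIV)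
    then show "integrable lborel (F k i)" by (simp add: F_def[abs_def])
    have "integrable lborel (\<lambda>p. indicator (K k) p *\<^sub>R
      (real (Suc k) * cutoff_deriv (real (Suc k) * \<rho> p) * d\<rho> i p * G i p
      + cutoff (real (Suc k) * \<rho> p) * dG i p))"
      by (rule borel_integrable_compact[OF cK]) (intro continuous_intros cuts cont subset_UNIV)
    then show "integrable lborel (dF k i)" by (simp add: dF_def[abs_def])
  qed
  have F_deriv: "((\<lambda>t. F k i (p + t *\<^sub>R v i)) has_real_derivative dF k i p) (at 0)"
    if i: "i \<in> I" for k i p
  proof (cases "p \<in> U")
    case True
    have op: "open ((\<lambda>t. p + t *\<^sub>R v i) -` U)"
      by (intro open_vimage \<open>open U\<close> continuous_intros)
    \<comment> \<open>On the open set \<open>U\<close> the cut-off field equals the product itself; off the compact set \<open>K k\<close> it is locally zero.\<close>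
    have "((\<lambda>t. cutoff (real (Suc k) * \<rho> (p + t *\<^sub>R v i)) * G i (p + t *\<^sub>R v i))
        has_real_derivative dF k i p) (at 0)"
      unfolding dF_U[OF True]
      by (rule derivative_eq_intros DERIV_chain2[OF cutoff_has_derivative]
            \<rho>_deriv[OF i True] G_deriv[OF i True] refl)+ simp
    then show ?thesis
      by (rule has_field_derivative_transform_within_open[OF _ op]) (use True F_U in auto)
  next
    case False
    have op: "open ((\<lambda>t. p + t *\<^sub>R v i) -` (- K k))"
      by (intro open_vimage open_Compl compact_imp_closed cK continuous_intros)
    have "((\<lambda>t::real. 0) has_real_derivative dF k i p) (at 0)"
      using False KU[of k] by (auto simp: dF_def indicator_def)
    then show ?thesis
      by (rule has_field_derivative_transform_within_open[OF _ op])
         (use False KU[of k] in \<open>auto simp: F_def indicator_def\<close>)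
  qed
  have "(LINT p|lborel. dF k i p) = 0" if "i \<in> I" for k i
    by (rule integral_directional_derivative_eq_0[OF F_int dF_int F_deriv]) (rule that)+
  then have zero: "(LINT p|lborel. h k p) = 0" for k
    unfolding h_def using dF_int by (subst Bochner_Integration.integral_sum) auto
  have h_U: "h k p = real (Suc k) * cutoff_deriv (real (Suc k) * \<rho> p) * (\<Sum>i\<in>I. G i p * d\<rho> i p)
      + cutoff (real (Suc k) * \<rho> p) * H p" if "p \<in> U" for k p
    using that by (simp add: h_def dF_U div[symmetric] sum.distrib sum_distrib_left
      sum_distrib_right algebra_simps)
  have h_out: "h k p = 0" if "p \<notin> U" for k p
    using that KU[of k] by (auto simp: h_def dF_def indicator_def intro!: sum.neutral)
  have first: "\<bar>real (Suc k) * cutoff_deriv (real (Suc k) * \<rho> p) * (\<Sum>i\<in>I. G i p * d\<rho> i p)\<bar>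
      \<le> (real (Suc k) * \<rho> p * cutoff_deriv (real (Suc k) * \<rho> p)) * C p" (is "?l \<le> _")
    if "p \<in> U" for k p
  proof -
    have nn: "0 \<le> cutoff_deriv t" for t by (simp add: cutoff_deriv_def)
    have "?l = real (Suc k) * cutoff_deriv (real (Suc k) * \<rho> p) * \<bar>\<Sum>i\<in>I. G i p * d\<rho> i p\<bar>"
      using nn by (simp add: abs_mult)
    also have "\<dots> \<le> real (Suc k) * cutoff_deriv (real (Suc k) * \<rho> p) * (C p * \<rho> p)"
      by (intro mult_left_mono tangent that mult_nonneg_nonneg nn) auto
    finally show ?thesis by (simp add: mult_ac)
  qed
  have C0: "0 \<le> C p" if "p \<in> U" for p
    using tangent[OF that] pos[OF that] by (smt (verit) zero_le_mult_iff)
  have "(\<lambda>k. LINT p|lborel. h k p) \<longlonglongrightarrow> (LINT p|lborel. indicator U p * H p)"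
  proof (rule integral_dominated_convergence)
    have "integrable lborel (\<lambda>p. 4 * (indicator U p * C p) + \<bar>indicator U p * H p\<bar>)"
      using H_int C_int by (auto simp: set_integrable_def)
    then show "integrable lborel (\<lambda>p. indicator U p * (4 * C p) + \<bar>indicator U p * H p\<bar>)"
      by (simp add: mult_ac)
    show "(\<lambda>p. indicator U p * H p) \<in> borel_measurable lborel"
      using H_int by (auto simp: set_integrable_def)
    show "h k \<in> borel_measurable lborel" for k
      unfolding h_def using dF_int by (intro borel_measurable_sum) auto
    show "AE p in lborel. norm (h k p) \<le> indicator U p * (4 * C p) + \<bar>indicator U p * H p\<bar>" for k
    proof (rule AE_I2)
      fix p
      show "norm (h k p) \<le> indicator U p * (4 * C p) + \<bar>indicator U p * H p\<bar>"
      proof (cases "p \<in> U")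
        case True
        have "(real (Suc k) * \<rho> p * cutoff_deriv (real (Suc k) * \<rho> p)) * C p \<le> 4 * C p"
          by (intro mult_right_mono cutoff_deriv_bounds C0[OF True]) (use pos[OF True] in auto)
        moreover have "\<bar>cutoff (real (Suc k) * \<rho> p) * H p\<bar> \<le> 1 * \<bar>H p\<bar>"
          unfolding abs_mult using cutoff_bounds by (intro mult_right_mono) auto
        ultimately have "\<bar>h k p\<bar> \<le> 4 * C p + \<bar>H p\<bar>"
          using first[OF True, of k] unfolding h_U[OF True] by linarith
        with True show ?thesis by simp
      qed (simp add: h_out)
    qed
    show "AE p in lborel. (\<lambda>k. h k p) \<longlonglongrightarrow> indicator U p * H p"
    proof (rule AE_I2)
      fix p
      show "(\<lambda>k. h k p) \<longlonglongrightarrow> indicator U p * H p"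
      proof (cases "p \<in> U")
        case True
        have l1: "(\<lambda>k. real (Suc k) * \<rho> p * cutoff_deriv (real (Suc k) * \<rho> p) * C p) \<longlonglongrightarrow> 0 * C p"
          by (intro tendsto_mult tendsto_const cutoff_limits pos[OF True])
        have "(\<lambda>k. real (Suc k) * cutoff_deriv (real (Suc k) * \<rho> p) * (\<Sum>i\<in>I. G i p * d\<rho> i p)) \<longlonglongrightarrow> 0"
          by (rule Lim_null_comparison[OF _ l1[simplified]]) (use first[OF True] in auto)
        moreover have "(\<lambda>k. cutoff (real (Suc k) * \<rho> p) * H p) \<longlonglongrightarrow> 1 * H p"
          by (intro tendsto_mult tendsto_const cutoff_limits pos[OF True])
        ultimately have "(\<lambda>k. h k p) \<longlonglongrightarrow> 0 + 1 * H p"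
          unfolding h_U[OF True] by (rule tendsto_add)
        with True show ?thesis by simp
      qed (simp add: h_out)
    qed
  qed
  then have "(LINT p|lborel. indicator U p * H p) = 0"
    unfolding zero using LIMSEQ_unique[OF _ tendsto_const] by metis
  then show ?thesis by (simp add: set_lebesgue_integral_def)
qed

section \<open>Polynomials of bounded degree\<close>

lemma polys_upto_mono:
  assumes "m \<le> n" "f \<in> polys_upto m"
  shows "f \<in> polys_upto n"
proof -
  from assms obtain c where f: "f = (\<lambda>p. \<Sum>\<alpha>\<in>multi_indices_upto m. c \<alpha> * monom_fun \<alpha> p)"
    unfolding polys_upto_def by auto
  show ?thesis unfolding f
    using assms(1) by (intro polys_upto_sum finite_multi_indices_upto polys_upto_cmult_monom)
      (auto simp: multi_indices_upto_def)
qed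

lemma polys_upto_const: "(\<lambda>_. c) \<in> polys_upto n"
  using polys_upto_cmult_monom[of "\<lambda>_. 0" n c] by (simp add: monom_fun_def)

lemma polys_upto_mult:
  assumes "f \<in> polys_upto m" "g \<in> polys_upto n"
  shows "(\<lambda>p. f p * g p) \<in> polys_upto (m + n)"
proof -
  from assms obtain c d where
    f: "f = (\<lambda>p. \<Sum>\<alpha>\<in>multi_indices_upto m. c \<alpha> * monom_fun \<alpha> p)" and
    g: "g = (\<lambda>p. \<Sum>\<beta>\<in>multi_indices_upto n. d \<beta> * monom_fun \<beta> p)"
    unfolding polys_upto_def by auto
  have mm: "monom_fun \<alpha> p * monom_fun \<beta> p = monom_fun (\<lambda>b. \<alpha> b + \<beta> b) p" for \<alpha> \<beta> and p :: 'a
    by (simp add: monom_fun_def power_add prod.distrib)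
  have "(\<lambda>p. f p * g p) = (\<lambda>p. \<Sum>\<alpha>\<in>multi_indices_upto m. \<Sum>\<beta>\<in>multi_indices_upto n.
      (c \<alpha> * d \<beta>) * monom_fun (\<lambda>b. \<alpha> b + \<beta> b) p)"
    unfolding f g sum_product mm[symmetric] by (simp add: mult_ac)
  also have "\<dots> \<in> polys_upto (m + n)"
    by (intro polys_upto_sum polys_upto_cmult_monom finite_multi_indices_upto)
       (auto simp: multi_indices_upto_def sum.distrib intro: add_mono)
  finally show ?thesis .
qed

lemma polys_upto_cmult: "f \<in> polys_upto n \<Longrightarrow> (\<lambda>p. c * f p) \<in> polys_upto n"
  using polys_upto_mult[OF polys_upto_const[of c 0], of f n] by simp

lemma polys_upto_diff:
  "f \<in> polys_upto n \<Longrightarrow> g \<in> polys_upto n \<Longrightarrow> (\<lambda>p. f p - g p) \<in> polys_upto n"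
  using polys_upto_add[OF _ polys_upto_cmult[of g n "-1"], of f] by simp

lemma polys_upto_inner_Basis:
  assumes "b \<in> Basis"
  shows "(\<lambda>p. p \<bullet> b) \<in> polys_upto 1"
proof -
  have "monom_fun (\<lambda>b'. if b' = b then 1 else 0) p = p \<bullet> b" for p :: 'a
  proof -
    have "monom_fun (\<lambda>b'. if b' = b then 1 else 0) p = (\<Prod>b'\<in>Basis. if b' = b then p \<bullet> b' else 1)"
      unfolding monom_fun_def by (intro prod.cong) auto
    with assms show ?thesis by simp
  qed
  with polys_upto_cmult_monom[of "\<lambda>b'. if b' = b then 1 else 0" 1 1] assms show ?thesis by simp
qed

lemma polys_upto_inner: "(\<lambda>p. p \<bullet> w) \<in> polys_upto 1"
proof -
  have "(\<lambda>p. p \<bullet> w) = (\<lambda>p. \<Sum>b\<in>Basis. (w \<bullet> b) * (p \<bullet> b))"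
    by (subst euclidean_inner) (simp add: mult.commute)
  also have "\<dots> \<in> polys_upto 1"
    by (intro polys_upto_sum polys_upto_cmult polys_upto_inner_Basis) auto
  finally show ?thesis .
qed

text \<open>
  Degree estimates below are proved by building polynomials up from constants by addition and
  multiplication by one coordinate, each such multiplication costing one degree. This replaces
  computations with multi-indices.
\<close>
lemma polys_upto_induct [consumes 1, case_names const add mult]:
  fixes f :: "'a::euclidean_space \<Rightarrow> real"
  assumes "f \<in> polys_upto n"
    and const: "\<And>n c. P n (\<lambda>_. c)"
    and add: "\<And>n f g. f \<in> polys_upto n \<Longrightarrow> g \<in> polys_upto n \<Longrightarrow> P n f \<Longrightarrow> P n g \<Longrightarrow> P n (\<lambda>p. f p + g p)"
    and mult: "\<And>n b f. b \<in> Basis \<Longrightarrow> f \<in> polys_upto n \<Longrightarrow> P n f \<Longrightarrow> P (Suc n) (\<lambda>p. (p \<bullet> b) * f p)"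
  shows "P n f"
proof -
  have monom: "P n (\<lambda>p. c * monom_fun \<alpha> p)" if "(\<Sum>b\<in>Basis. \<alpha> b) \<le> n" for n c and \<alpha> :: "'a \<Rightarrow> nat"
    using that
  proof (induction n arbitrary: \<alpha>)
    case 0
    then have "monom_fun \<alpha> p = 1" for p by (simp add: monom_fun_def)
    then show ?case using const by simp
  next
    case (Suc n)
    show ?case
    proof (cases "\<forall>b\<in>Basis. \<alpha> b = 0")
      case True
      then have "monom_fun \<alpha> p = 1" for p by (simp add: monom_fun_def)
      then show ?thesis using const by simp
    next
      case False
      then obtain b where b: "b \<in> Basis" "\<alpha> b > 0" by auto
      define \<beta> where "\<beta> = \<alpha>(b := \<alpha> b - 1)"
      have same: "prod (\<lambda>b'. F b' (\<beta> b')) (Basis - {b}) = prod (\<lambda>b'. F b' (\<alpha> b')) (Basis - {b})"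
        for F :: "'a \<Rightarrow> nat \<Rightarrow> real"
        by (intro prod.cong) (auto simp: \<beta>_def)
      have "sum \<beta> (Basis - {b}) = sum \<alpha> (Basis - {b})"
        by (intro sum.cong) (auto simp: \<beta>_def)
      then have "sum \<beta> Basis \<le> n"
        using Suc.prems b by (simp add: sum.remove[of Basis b] \<beta>_def)
      then have "P n (\<lambda>p. c * monom_fun \<beta> p)" "(\<lambda>p. c * monom_fun \<beta> p) \<in> polys_upto n"
        by (auto intro: Suc.IH polys_upto_cmult_monom)
      from mult[OF b(1) this(2,1)]
      have "P (Suc n) (\<lambda>p. (p \<bullet> b) * (c * monom_fun \<beta> p))" .
      moreover have "(p \<bullet> b) * (c * monom_fun \<beta> p) = c * monom_fun \<alpha> p" for p
      proof -
        have "(p \<bullet> b) * (p \<bullet> b) ^ \<beta> b = (p \<bullet> b) ^ \<alpha> b"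
          using b by (simp add: \<beta>_def power_eq_if)
        then show ?thesis
          using b same[of "\<lambda>b' k. (p \<bullet> b') ^ k"]
          by (simp add: monom_fun_def prod.remove[of Basis b] mult_ac)
      qed
      ultimately show ?thesis by simp
    qed
  qed
  from assms(1) obtain c where f: "f = (\<lambda>p. \<Sum>\<alpha>\<in>multi_indices_upto n. c \<alpha> * monom_fun \<alpha> p)"
    unfolding polys_upto_def by auto
  have "P n (\<lambda>p. \<Sum>\<alpha>\<in>A. c \<alpha> * monom_fun \<alpha> p) \<and> (\<lambda>p. \<Sum>\<alpha>\<in>A. c \<alpha> * monom_fun \<alpha> p) \<in> polys_upto n"
    if "finite A" "A \<subseteq> multi_indices_upto n" for A
    using that
    by (induction A rule: finite_induct)
       (auto intro!: const add monom polys_upto_add polys_upto_cmult_monom polys_upto_0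
             simp: multi_indices_upto_def)
  from this[OF finite_multi_indices_upto] show ?thesis unfolding f by simp
qed

lemma polys_upto_real_polynomial_function: "f \<in> polys_upto n \<Longrightarrow> real_polynomial_function f"
  unfolding real_polynomial_function_iff by blast

lemma total_degree_le_iff:
  assumes "real_polynomial_function f"
  shows "total_degree f \<le> n \<longleftrightarrow> f \<in> polys_upto n"
proof
  obtain m where "f \<in> polys_upto m" using assms unfolding real_polynomial_function_iff by blast
  then have "f \<in> polys_upto (total_degree f)" unfolding total_degree_def by (rule LeastI)
  then show "f \<in> polys_upto n" if "total_degree f \<le> n" using that polys_upto_mono by blast
  show "total_degree f \<le> n" if "f \<in> polys_upto n"
    unfolding total_degree_def using that by (rule Least_le)
qed

text \<open>
  On the line through a point of \<open>S\<close> and an arbitrary point, the function is a polynomial in one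
  variable with infinitely many zeros.
\<close>
lemma real_polynomial_function_eq_0_if_vanishes_on_open:
  fixes f :: "'a::euclidean_space \<Rightarrow> real"
  assumes f: "real_polynomial_function f" and "open S" "S \<noteq> {}" and zero: "\<And>p. p \<in> S \<Longrightarrow> f p = 0"
  shows "f = (\<lambda>_. 0)"
proof
  fix p
  obtain q where q: "q \<in> S" using \<open>S \<noteq> {}\<close> by auto
  define \<gamma> where "\<gamma> = (\<lambda>t::real. q + t *\<^sub>R (p - q))"
  have "polynomial_function \<gamma>"
    unfolding \<gamma>_def
    by (intro polynomial_function_add polynomial_function_const polynomial_function_mult
          polynomial_function_id[unfolded id_def] polynomial_function_bounded_linear bounded_linear_scaleR_left)
  then have "real_polynomial_function (f \<circ> \<gamma>)"
    using f by (rule real_polynomial_function_compose)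
  then obtain a n where a: "f \<circ> \<gamma> = (\<lambda>t. \<Sum>i\<le>n. a i * t ^ i)"
    unfolding real_polynomial_function_iff_sum by blast
  have "open (\<gamma> -` S)"
    unfolding \<gamma>_def by (intro open_vimage \<open>open S\<close> continuous_intros)
  moreover have "0 \<in> \<gamma> -` S" using q by (simp add: \<gamma>_def)
  ultimately have "infinite (\<gamma> -` S)"
    using finite_imp_not_open by auto
  moreover have "\<gamma> -` S \<subseteq> {t. (\<Sum>i\<le>n. a i * t ^ i) = 0}"
    using zero unfolding a[unfolded fun_eq_iff o_def, rule_format, symmetric] by auto
  ultimately have "infinite {t. (\<Sum>i\<le>n. a i * t ^ i) = 0}"
    using finite_subset by blast
  then have "\<forall>i\<le>n. a i = 0"
    using polyfun_finite_roots[of a n] by blast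
  then have "(f \<circ> \<gamma>) 1 = 0" unfolding a by simp
  then show "f p = 0" by (simp add: \<gamma>_def)
qed

section \<open>Directional derivatives of polynomials\<close>

lemma real_polynomial_function_differentiable:
  fixes f :: "'a::euclidean_space \<Rightarrow> real"
  assumes "real_polynomial_function f"
  shows "f differentiable (at p)"
  using assms by induction (auto intro: bounded_linear_imp_differentiable)

lemma dir_deriv_eq:
  assumes "(f has_derivative f') (at p)"
  shows "dir_deriv v f p = f' v"
    and "((\<lambda>t. f (p + t *\<^sub>R v)) has_real_derivative f' v) (at 0)"
proof -
  interpret bounded_linear f' using assms by (rule has_derivative_bounded_linear)
  have "((\<lambda>t. f (p + t *\<^sub>R v)) has_derivative (\<lambda>t. f' (t *\<^sub>R v))) (at 0)"
    by (rule has_derivative_compose[of "\<lambda>t. p + t *\<^sub>R v", where f' = "\<lambda>t. t *\<^sub>R v"])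
       (auto intro!: derivative_eq_intros assms)
  moreover have "(\<lambda>t. f' (t *\<^sub>R v)) = (*) (f' v)"
    by (simp add: fun_eq_iff scaleR)
  ultimately show "((\<lambda>t. f (p + t *\<^sub>R v)) has_real_derivative f' v) (at 0)"
    by (simp add: has_field_derivative_def)
  then show "dir_deriv v f p = f' v"
    unfolding dir_deriv_def by (rule DERIV_imp_deriv)
qed

lemma dir_deriv_has_derivative:
  fixes f :: "'a::euclidean_space \<Rightarrow> real"
  assumes "real_polynomial_function f"
  shows "((\<lambda>t. f (p + t *\<^sub>R v)) has_real_derivative dir_deriv v f p) (at 0)"
    and "(f has_derivative (\<lambda>v. dir_deriv v f p)) (at p)"
proof -
  obtain f' where f': "(f has_derivative f') (at p)"
    using real_polynomial_function_differentiable[OF assms] unfolding differentiable_def by blast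
  have eq: "(\<lambda>v. dir_deriv v f p) = f'"
    by (rule ext) (rule dir_deriv_eq(1)[OF f'])
  show "(f has_derivative (\<lambda>v. dir_deriv v f p)) (at p)"
    unfolding eq by (rule f')
  show "((\<lambda>t. f (p + t *\<^sub>R v)) has_real_derivative dir_deriv v f p) (at 0)"
    unfolding dir_deriv_eq(1)[OF f'] by (rule dir_deriv_eq(2)[OF f'])
qed

lemma dir_deriv_const: "dir_deriv v (\<lambda>_. c) = (\<lambda>_. 0)"
  by (simp add: dir_deriv_def fun_eq_iff)

lemma dir_deriv_add:
  assumes "real_polynomial_function f" "real_polynomial_function g"
  shows "dir_deriv v (\<lambda>p. f p + g p) p = dir_deriv v f p + dir_deriv v g (p :: 'a::euclidean_space)"
  using dir_deriv_eq(1)[OF has_derivative_add[OF assms[THEN dir_deriv_has_derivative(2)]]] .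

lemma dir_deriv_mult:
  assumes "real_polynomial_function f" "real_polynomial_function g"
  shows "dir_deriv v (\<lambda>p. f p * g p) p = f p * dir_deriv v g p + dir_deriv v f p * g (p :: 'a::euclidean_space)"
  using dir_deriv_eq(1)[OF has_derivative_mult[OF assms[THEN dir_deriv_has_derivative(2)]]] .

lemma dir_deriv_diff:
  assumes "real_polynomial_function f" "real_polynomial_function g"
  shows "dir_deriv v (\<lambda>p. f p - g p) p = dir_deriv v f p - dir_deriv v g (p :: 'a::euclidean_space)"
  using dir_deriv_eq(1)[OF has_derivative_diff[OF assms[THEN dir_deriv_has_derivative(2)]]] .

lemma dir_deriv_inner: "dir_deriv v (\<lambda>p. p \<bullet> b) p = v \<bullet> (b :: 'a::euclidean_space)"
  by (rule dir_deriv_eq(1)[where f' = "\<lambda>v. v \<bullet> b"])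
     (rule bounded_linear_imp_has_derivative[OF bounded_linear_inner_left])

text \<open>
  The conjunct for degree 0 carries the information that truncated subtraction in \<open>n - 1\<close> loses;
  without it the induction step from degree 0 would fail.
\<close>
lemma polys_upto_dir_deriv:
  fixes f :: "'a::euclidean_space \<Rightarrow> real"
  assumes "f \<in> polys_upto n"
  shows "dir_deriv v f \<in> polys_upto (n - 1) \<and> (n = 0 \<longrightarrow> dir_deriv v f = (\<lambda>_. 0))"
  using assms
proof (induction rule: polys_upto_induct)
  case (const n c)
  show ?case by (simp add: dir_deriv_const polys_upto_const)
next
  case (add n f g)
  note rpf = add(1,2)[THEN polys_upto_real_polynomial_function]
  have eq: "dir_deriv v (\<lambda>p. f p + g p) = (\<lambda>p. dir_deriv v f p + dir_deriv v g p)"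
    by (rule ext) (rule dir_deriv_add[OF rpf])
  show ?case
    unfolding eq using add polys_upto_add[of "dir_deriv v f" "n - 1" "dir_deriv v g"] by simp
next
  case (mult n b f)
  note rpf = polys_upto_inner[THEN polys_upto_real_polynomial_function]
    mult(2)[THEN polys_upto_real_polynomial_function]
  have eq: "dir_deriv v (\<lambda>p. (p \<bullet> b) * f p) = (\<lambda>p. (p \<bullet> b) * dir_deriv v f p + (v \<bullet> b) * f p)"
    by (rule ext) (simp only: dir_deriv_mult[OF rpf] dir_deriv_inner)
  have "(\<lambda>p. (p \<bullet> b) * dir_deriv v f p) \<in> polys_upto n"
  proof (cases n)
    case 0
    with mult have "dir_deriv v f = (\<lambda>_. 0)" by simp
    then show ?thesis by (simp add: polys_upto_const)
  next
    case (Suc k)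
    with mult polys_upto_mult[OF polys_upto_inner, of "dir_deriv v f" k b] show ?thesis by simp
  qed
  from polys_upto_add[OF this polys_upto_cmult[OF mult(2)]] show ?case
    unfolding eq by simp
qed

text \<open>
  Euler's identity for the homogeneous part of top degree: multiplication by a coordinate \<open>p \<bullet> b\<close>
  intertwines \<open>E - n\<close> with \<open>E - (n + 1)\<close>, where \<open>E\<close> is differentiation along \<open>p\<close>, and on constants
  \<open>E\<close> is zero.
\<close>
lemma polys_upto_euler:
  fixes f :: "'a::euclidean_space \<Rightarrow> real"
  assumes "f \<in> polys_upto n"
  shows "(\<lambda>p. dir_deriv p f p - real n * f p) \<in> polys_upto (n - 1) \<and>
    (n = 0 \<longrightarrow> (\<forall>p. dir_deriv p f p = 0))"
  using assms
proof (induction rule: polys_upto_induct)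
  case (const n c)
  show ?case by (simp add: dir_deriv_const polys_upto_const)
next
  case (add n f g)
  note rpf = add(1,2)[THEN polys_upto_real_polynomial_function]
  have "(\<lambda>p. dir_deriv p (\<lambda>p. f p + g p) p - real n * (f p + g p)) =
      (\<lambda>p. (dir_deriv p f p - real n * f p) + (dir_deriv p g p - real n * g p))"
    by (rule ext) (simp add: dir_deriv_add[OF rpf] algebra_simps)
  moreover have "(\<lambda>p. (dir_deriv p f p - real n * f p) + (dir_deriv p g p - real n * g p))
      \<in> polys_upto (n - 1)"
    using add by (intro polys_upto_add) blast+
  ultimately show ?case
    using add by (simp add: dir_deriv_add[OF rpf])
next
  case (mult n b f)
  note rpf = polys_upto_inner[THEN polys_upto_real_polynomial_function]
    mult(2)[THEN polys_upto_real_polynomial_function]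
  have "dir_deriv p (\<lambda>p. (p \<bullet> b) * f p) p = (p \<bullet> b) * dir_deriv p f p + (p \<bullet> b) * f p" for p
    by (simp only: dir_deriv_mult[OF rpf] dir_deriv_inner)
  then have eq: "(\<lambda>p. dir_deriv p (\<lambda>p. (p \<bullet> b) * f p) p - real (Suc n) * ((p \<bullet> b) * f p)) =
      (\<lambda>p. (p \<bullet> b) * (dir_deriv p f p - real n * f p))"
    by (simp add: fun_eq_iff algebra_simps)
  have "(\<lambda>p. (p \<bullet> b) * (dir_deriv p f p - real n * f p)) \<in> polys_upto n"
  proof (cases n)
    case 0
    with mult have "\<forall>p. dir_deriv p f p = 0" by simp
    with 0 show ?thesis by (simp add: polys_upto_const)
  next
    case (Suc k)
    with mult polys_upto_mult[OF polys_upto_inner, of "\<lambda>p. dir_deriv p f p - real n * f p" k b]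
    show ?thesis by simp
  qed
  with eq show ?case by simp
qed

section \<open>Integrability of the weight\<close>

lemma nn_integral_lborel_dilate:
  fixes f :: "'a::euclidean_space \<Rightarrow> ennreal"
  assumes [measurable]: "f \<in> borel_measurable borel" and c: "c > 0"
  shows "(\<integral>\<^sup>+p. f p \<partial>lborel) = ennreal (c ^ DIM('a)) * (\<integral>\<^sup>+p. f (c *\<^sub>R p) \<partial>lborel)"
proof -
  have "(\<integral>\<^sup>+p. f p \<partial>lborel) =
      (\<integral>\<^sup>+p. f p \<partial>density (distr lborel borel (\<lambda>x. 0 + c *\<^sub>R x)) (\<lambda>_. \<bar>c\<bar> ^ DIM('a)))"
    using lborel_affine[of c "0::'a"] c by simp
  also have "\<dots> = ennreal (c ^ DIM('a)) * (\<integral>\<^sup>+p. f (c *\<^sub>R p) \<partial>lborel)"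
    using c by (simp add: nn_integral_density nn_integral_distr nn_integral_cmult)
  finally show ?thesis .
qed

lemma nn_integral_powr_unit_finite:
  fixes a :: real
  assumes "a > -1"
  shows "(\<integral>\<^sup>+t. ennreal (t powr a * indicator {0..1} t) \<partial>lborel) < \<infinity>"
proof -
  have "(\<integral>\<^sup>+t. ennreal (t powr a * indicator {0..1} t) \<partial>lborel) =
      (\<integral>\<^sup>+t. ennreal (t powr a) * indicator {0..1} t \<partial>lborel)"
    by (intro nn_integral_cong) (auto simp: indicator_def)
  also have "\<dots> = ennreal (1 powr (a + 1) / (a + 1))"
    by (rule nn_integral_has_integral_lebesgue'[OF _ has_integral_powr_from_0]) (use assms in auto)
  finally show ?thesis by simp
qed

text \<open>
  The exponents are the coordinates of a vector \<open>q\<close>, so that no separate indexing of the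
  coordinates of a product space is needed.
\<close>
definition monom_powr :: "'a::euclidean_space \<Rightarrow> 'a \<Rightarrow> real" where
  "monom_powr q p = (\<Prod>b\<in>Basis. \<bar>p \<bullet> b\<bar> powr (q \<bullet> b))"

lemma monom_powr_measurable [measurable]: "monom_powr q \<in> borel_measurable borel"
  unfolding monom_powr_def by measurable

lemma monom_powr_nonneg: "0 \<le> monom_powr q p"
  unfolding monom_powr_def by (simp add: prod_nonneg)

lemma nn_integral_monom_powr_cube_finite:
  fixes q :: "'a::euclidean_space"
  assumes "\<And>b. b \<in> Basis \<Longrightarrow> q \<bullet> b > -1"
  shows "(\<integral>\<^sup>+p. ennreal (monom_powr q p * indicator {p. \<forall>b\<in>Basis. \<bar>p \<bullet> b\<bar> \<le> 1} p) \<partial>lborel) < \<infinity>"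
proof -
  define f :: "'a \<Rightarrow> real \<Rightarrow> ennreal"
    where "f = (\<lambda>b t. ennreal (\<bar>t\<bar> powr (q \<bullet> b) * indicator {-1..1} t))"
  have fin: "(\<integral>\<^sup>+t. f b t \<partial>lborel) < \<infinity>" if "b \<in> Basis" for b
  proof -
    define g where "g = (\<lambda>t. ennreal (t powr (q \<bullet> b) * indicator {0..1} t))"
    have [measurable]: "g \<in> borel_measurable borel" unfolding g_def by measurable
    have "(\<integral>\<^sup>+t. f b t \<partial>lborel) \<le> (\<integral>\<^sup>+t. g t + g (0 + (- 1) * t) \<partial>lborel)"
      by (intro nn_integral_mono) (auto simp: f_def g_def indicator_def abs_if)
    also have "\<dots> = (\<integral>\<^sup>+t. g t \<partial>lborel) + (\<integral>\<^sup>+t. g t \<partial>lborel)"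
      by (subst nn_integral_add) (simp_all add: nn_integral_real_affine[of g "-1" 0])
    also have "\<dots> < \<infinity>"
      using nn_integral_powr_unit_finite[OF assms[OF that]] by (simp add: g_def)
    finally show ?thesis .
  qed
  have "(\<integral>\<^sup>+p. ennreal (monom_powr q p * indicator {p. \<forall>b\<in>Basis. \<bar>p \<bullet> b\<bar> \<le> 1} p) \<partial>lborel)
      = (\<integral>\<^sup>+p. (\<Prod>b\<in>Basis. f b (p \<bullet> b)) \<partial>lborel)"
  proof (intro nn_integral_cong)
    fix p :: 'a
    have "monom_powr q p * indicator {p. \<forall>b\<in>Basis. \<bar>p \<bullet> b\<bar> \<le> 1} p =
        (\<Prod>b\<in>Basis. \<bar>p \<bullet> b\<bar> powr (q \<bullet> b) * indicator {-1..1} (p \<bullet> b))"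
    proof (cases "\<forall>b\<in>Basis. \<bar>p \<bullet> b\<bar> \<le> 1")
      case True
      then show ?thesis
        unfolding monom_powr_def prod.distrib by (auto simp: indicator_def abs_le_iff intro!: prod.neutral)
    next
      case False
      then obtain b where b: "b \<in> Basis" "\<not> \<bar>p \<bullet> b\<bar> \<le> 1" by auto
      then have "indicator {-1..1} (p \<bullet> b) = (0::real)" by (auto simp: indicator_def)
      with b False show ?thesis by (auto simp: prod_zero_iff)
    qed
    then show "ennreal (monom_powr q p * indicator {p. \<forall>b\<in>Basis. \<bar>p \<bullet> b\<bar> \<le> 1} p) =
        (\<Prod>b\<in>Basis. f b (p \<bullet> b))"
      by (simp add: f_def prod_ennreal)
  qed
  also have "\<dots> = (\<Prod>b\<in>Basis. (\<integral>\<^sup>+t. f b t \<partial>lborel))"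
    by (rule nn_integral_lborel_prod) (auto simp: f_def)
  also have "\<dots> < \<infinity>"
    using fin by (auto simp: less_top[symmetric] ennreal_prod_eq_top)
  finally show ?thesis .
qed

text \<open>
  The factor \<open>(1 - N p) powr \<gamma>\<close> is singular on the unit sphere of \<open>N\<close>, which a dilation moves
  transversally. Replacing the integrand by its average over the dilations \<open>p \<mapsto> p / c\<close> with
  \<open>1/2 \<le> c \<le> 1\<close> changes the integral by a bounded factor, and turns the singularity into the convergent
  one-dimensional integral of \<open>t powr \<gamma>\<close> over the unit interval.
\<close>
lemma nn_integral_radial_boundary_singularity_finite:
  fixes N w :: "'a::euclidean_space \<Rightarrow> real"
  assumes [measurable]: "N \<in> borel_measurable borel" "w \<in> borel_measurable borel"
    and w0: "\<And>p. 0 \<le> w p" and N0: "\<And>p. 0 \<le> N p"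
    and N_hom: "\<And>c p. c > 0 \<Longrightarrow> N (c *\<^sub>R p) = c * N p"
    and w_hom: "\<And>c p. c \<ge> 1 \<Longrightarrow> w (c *\<^sub>R p) \<le> w p"
    and \<gamma>: "-1 < \<gamma>" "\<gamma> \<le> 0"
    and fin: "(\<integral>\<^sup>+p. ennreal (w p * indicator {p. N p < 1} p) \<partial>lborel) < \<infinity>"
  shows "(\<integral>\<^sup>+p. ennreal (w p * (1 - N p) powr \<gamma> * indicator {p. N p < 1} p) \<partial>lborel) < \<infinity>"
proof -
  define h where "h = (\<lambda>p. w p * (1 - N p) powr \<gamma> * indicator {p. N p < 1} p)"
  define J where "J = (\<integral>\<^sup>+p. ennreal (h p) \<partial>lborel)"
  define T where "T = (\<integral>\<^sup>+t. ennreal (t powr \<gamma> * indicator {0..1} t) \<partial>lborel)"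
  define I :: "real set" where "I = {1/2..1}"
  define k where "k = (\<lambda>(c, p). ennreal (w p * indicator {p. N p < 1} p) *
    ennreal ((c - N p) powr \<gamma> * indicator {0..1} (c - N p)))"
  have [measurable]: "h \<in> borel_measurable borel" unfolding h_def by measurable
  have [measurable]: "k \<in> borel_measurable (lborel \<Otimes>\<^sub>M lborel)" unfolding k_def by measurable
  have h_dil: "ennreal (h ((1 / c) *\<^sub>R p)) \<le> k (c, p)" if c: "c \<in> I" for c p
  proof (cases "N p < c")
    case True
    have c': "c > 0" "c \<le> 1" "1 / c \<ge> 1" using c by (auto simp: I_def)
    have "N ((1 / c) *\<^sub>R p) = N p / c" using c' N_hom[of "1 / c" p] by simp
    \<comment> \<open>Since \<open>\<gamma> \<le> 0\<close> the power is decreasing, and \<open>c (1 - N p / c) = c - N p\<close> with \<open>c \<le> 1\<close>; the right-hand side is a translate in \<open>c\<close> of a fixed function.\<close>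
    moreover have "(1 - N p / c) powr \<gamma> \<le> (c - N p) powr \<gamma>"
    proof (rule powr_mono2')
      have "c * (1 - N p / c) \<le> 1 * (1 - N p / c)"
        using c' True by (intro mult_right_mono) auto
      then show "c - N p \<le> 1 - N p / c" using c' by (simp add: algebra_simps)
    qed (use \<gamma> True in auto)
    moreover have "w ((1 / c) *\<^sub>R p) \<le> w p" by (rule w_hom) (rule c')
    ultimately have "h ((1 / c) *\<^sub>R p) \<le> w p * (c - N p) powr \<gamma>"
      using c' True w0 unfolding h_def by (auto intro!: mult_mono simp: indicator_def)
    moreover have "k (c, p) = ennreal (w p * (c - N p) powr \<gamma>)"
      using c' True N0[of p] w0[of p] by (simp add: k_def ennreal_mult')
    ultimately show ?thesis by (simp add: ennreal_leI)
  next
    case False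
    moreover have "N ((1 / c) *\<^sub>R p) = N p / c" "c > 0"
      using c N_hom[of "1 / c" p] by (auto simp: I_def)
    ultimately have "\<not> N ((1 / c) *\<^sub>R p) < 1" by simp
    then show ?thesis by (simp add: h_def)
  qed
  have dil: "J \<le> ennreal (2 ^ DIM('a)) * (\<integral>\<^sup>+p. k (c, p) \<partial>lborel)" if c: "c \<in> I" for c
  proof -
    have c': "1 / c > 0" "1 / c \<le> 2" using c by (auto simp: I_def field_simps)
    have "J = ennreal ((1 / c) ^ DIM('a)) * (\<integral>\<^sup>+p. ennreal (h ((1 / c) *\<^sub>R p)) \<partial>lborel)"
      unfolding J_def by (rule nn_integral_lborel_dilate) (use c' in auto)
    also have "\<dots> \<le> ennreal (2 ^ DIM('a)) * (\<integral>\<^sup>+p. k (c, p) \<partial>lborel)"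
      using c' c by (intro mult_mono ennreal_leI power_mono nn_integral_mono h_dil) auto
    finally show ?thesis .
  qed
  have slice: "(\<integral>\<^sup>+c. k (c, p) \<partial>lborel) = ennreal (w p * indicator {p. N p < 1} p) * T" for p
  proof -
    have "T = (\<integral>\<^sup>+c. ennreal ((c - N p) powr \<gamma> * indicator {0..1} (c - N p)) \<partial>lborel)"
      unfolding T_def by (subst nn_integral_real_affine[of _ 1 "- N p"]) auto
    then show ?thesis by (simp add: k_def nn_integral_cmult)
  qed
  have "ennreal (1/2) * J = (\<integral>\<^sup>+c. J * indicator I c \<partial>lborel)"
    by (simp add: nn_integral_cmult I_def mult.commute)
  also have "\<dots> \<le> (\<integral>\<^sup>+c. ennreal (2 ^ DIM('a)) * (\<integral>\<^sup>+p. k (c, p) \<partial>lborel) \<partial>lborel)"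
    using dil by (intro nn_integral_mono) (auto simp: indicator_def)
  also have "\<dots> = ennreal (2 ^ DIM('a)) * (\<integral>\<^sup>+c. (\<integral>\<^sup>+p. k (c, p) \<partial>lborel) \<partial>lborel)"
    by (rule nn_integral_cmult) measurable
  also have "(\<integral>\<^sup>+c. (\<integral>\<^sup>+p. k (c, p) \<partial>lborel) \<partial>lborel) = (\<integral>\<^sup>+p. (\<integral>\<^sup>+c. k (c, p) \<partial>lborel) \<partial>lborel)"
    by (rule lborel_pair.Fubini'[symmetric]) simp
  also have "\<dots> = (\<integral>\<^sup>+p. ennreal (w p * indicator {p. N p < 1} p) \<partial>lborel) * T"
    unfolding slice by (rule nn_integral_multc) measurable
  also have "ennreal (2 ^ DIM('a)) * \<dots> < \<infinity>"
    using fin nn_integral_powr_unit_finite[OF \<gamma>(1)] by (simp add: T_def ennreal_mult_less_top)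
  finally have "ennreal (1/2) * J < \<infinity>" .
  then have "J < \<infinity>" by (auto simp: ennreal_mult_less_top less_top ennreal_mult_eq_top_iff)
  then show ?thesis by (simp add: J_def h_def)
qed

lemma prod_Basis_prod_vec:
  fixes f :: "(real^'m) \<times> (real^'n) \<Rightarrow> real"
  shows "(\<Prod>b\<in>Basis. f b) = (\<Prod>i\<in>UNIV. f (axis i 1, 0)) * (\<Prod>j\<in>UNIV. f (0, axis j 1))"
proof -
  have vec: "(\<Prod>b\<in>Basis. g b) = (\<Prod>i\<in>UNIV. g (axis i 1))" for g :: "real^'k \<Rightarrow> real"
  proof -
    have "(Basis :: (real^'k) set) = range (\<lambda>i. axis i 1)"
      by (auto simp: Basis_vec_def)
    then show ?thesis
      using prod.reindex[of "\<lambda>i. axis i (1::real)" UNIV g]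
      by (simp only: inj_on_def axis_eq_axis o_def) simp
  qed
  have "inj_on (\<lambda>u. (u, 0 :: real^'n)) (Basis :: (real^'m) set)"
    "inj_on (\<lambda>u. (0 :: real^'m, u)) (Basis :: (real^'n) set)"
    by (auto intro!: inj_onI)
  then have "(\<Prod>b\<in>Basis. f b) = (\<Prod>b\<in>Basis. f (b, 0)) * (\<Prod>b\<in>Basis. f (0, b))"
    unfolding Basis_prod_def
    by (subst prod.union_disjoint) (auto simp: prod.reindex)
  then show ?thesis by (simp add: vec)
qed

lemma ball_simplex_iff:
  "(x, y) \<in> ball_simplex \<longleftrightarrow> (\<forall>j. 0 \<le> y $ j) \<and> norm x \<le> 1 - csum y"
proof -
  have "csum y \<le> 1" if "norm x \<le> 1 - csum y"
    using that norm_ge_zero[of x] by linarith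
  then show ?thesis unfolding ball_simplex_def std_simplex_def by auto
qed

lemma csum_nonneg: "(\<And>j. 0 \<le> y $ j) \<Longrightarrow> 0 \<le> csum y"
  unfolding csum_def by (rule sum_nonneg) auto

lemma le_csum: "(\<And>j. 0 \<le> y $ j) \<Longrightarrow> y $ k \<le> csum y"
  unfolding csum_def by (rule member_le_sum) auto

lemma continuous_on_csum [continuous_intros]:
  "continuous_on S f \<Longrightarrow> continuous_on S (\<lambda>p. csum (f p))"
  unfolding csum_def by (intro continuous_intros)

lemma compact_ball_simplex: "compact (ball_simplex :: ((real^'m) \<times> (real^'n)) set)"
proof (rule compact_eq_bounded_closed[THEN iffD2], intro conjI)
  have "norm p \<le> 2" if "p \<in> ball_simplex" for p :: "(real^'m) \<times> (real^'n)"
  proof -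
    obtain x y where p: "p = (x, y)" by fastforce
    with that have y: "\<And>j. 0 \<le> y $ j" and x: "norm x \<le> 1 - csum y"
      by (auto simp: ball_simplex_iff)
    have "norm y \<le> (\<Sum>j\<in>UNIV. \<bar>y $ j\<bar>)" by (rule norm_le_l1_cart)
    also have "\<dots> = csum y" using y by (simp add: csum_def)
    finally have "norm y \<le> csum y" .
    moreover have "norm p \<le> norm x + norm y" unfolding p by (rule norm_Pair_le)
    ultimately show ?thesis using x by linarith
  qed
  then show "bounded (ball_simplex :: ((real^'m) \<times> (real^'n)) set)"
    unfolding bounded_iff by blast
  have eq: "(ball_simplex :: ((real^'m) \<times> (real^'n)) set) =
      (\<Inter>j. {p. 0 \<le> snd p $ j}) \<inter> {p. norm (fst p) \<le> 1 - csum (snd p)}"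
    by (auto simp: ball_simplex_iff)
  show "closed (ball_simplex :: ((real^'m) \<times> (real^'n)) set)"
    unfolding eq by (intro closed_Int closed_INT ballI closed_Collect_le continuous_intros)
qed

lemma weight_BT_measurable [measurable]:
  "weight_BT \<mu> (\<kappa> :: real^'n) \<in> borel_measurable (borel :: ((real^'m) \<times> (real^'n)) measure)"
proof -
  have [measurable]: "csum \<in> borel_measurable (borel :: (real^'n) measure)"
    unfolding csum_def[abs_def] by measurable
  have "(\<lambda>p. (\<Prod>j\<in>UNIV. snd p $ j powr \<kappa> $ j) *
      ((1 - csum (snd p))\<^sup>2 - (norm (fst p))\<^sup>2) powr (\<mu> - 1/2))
      \<in> borel_measurable (borel \<Otimes>\<^sub>M borel :: ((real^'m) \<times> (real^'n)) measure)"
    by measurable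
  then show ?thesis by (simp add: weight_BT_def borel_prod case_prod_unfold)
qed

lemma weight_BT_nonneg: "0 \<le> weight_BT \<mu> \<kappa> p"
  by (auto simp: weight_BT_def split: prod.split intro!: mult_nonneg_nonneg prod_nonneg)

text \<open>
  The bound separates the singularities. With \<open>s = 1 - |y|\<close>, the radicand is
  \<open>(s - |x|) (s + |x|)\<close>, the second factor is at least \<open>|x_k|\<close>, and all bases are at most 1, so that
  replacing an exponent by its minimum with 0 only enlarges the power. Coordinates equal to zero
  are excluded because \<open>0 powr a = 0\<close> also for negative \<open>a\<close>.
\<close>
lemma weight_BT_le_monom_powr:
  fixes \<mu> :: real and x :: "real^'m" and y :: "real^'n" and \<kappa> :: "real^'n" and k :: 'm
  defines "e \<equiv> min (\<mu> - 1/2) 0"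
  defines "q \<equiv> (e *\<^sub>R axis k 1, \<chi> j. min (\<kappa> $ j) 0)"
  assumes p: "(x, y) \<in> ball_simplex" and "norm x < 1 - csum y"
    and nz: "\<And>b. b \<in> Basis \<Longrightarrow> (x, y) \<bullet> b \<noteq> 0"
  shows "weight_BT \<mu> \<kappa> (x, y) \<le> monom_powr q (x, y) * (1 - csum y - norm x) powr e"
proof -
  define s where "s = 1 - csum y"
  have y: "y $ j > 0" for j
    using p nz[of "(0, axis j 1)"] by (auto simp: ball_simplex_iff Basis_prod_def less_le inner_axis axis_in_Basis_iff)
  have x: "x $ i \<noteq> 0" for i
    using nz[of "(axis i 1, 0)"] by (auto simp: Basis_prod_def inner_axis axis_in_Basis_iff)
  have s: "norm x < s" "s \<le> 1" using assms csum_nonneg[of y] by (auto simp: s_def y less_imp_le)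
  have R: "s\<^sup>2 - (norm x)\<^sup>2 = (s - norm x) * (s + norm x)"
    by (simp add: power2_eq_square algebra_simps)
  have xk: "0 < \<bar>x $ k\<bar>" "\<bar>x $ k\<bar> \<le> s + norm x"
    using x s component_le_norm_cart[of x k] norm_ge_zero[of x] by auto
  have pos: "0 < s\<^sup>2 - (norm x)\<^sup>2" unfolding R using s xk by (intro mult_pos_pos) auto
  have "0 \<le> s" using s norm_ge_zero[of x] by linarith
  with s have "s\<^sup>2 \<le> 1" by (simp add: power_le_one)
  then have le1: "s\<^sup>2 - (norm x)\<^sup>2 \<le> 1" using zero_le_power2[of "norm x"] by linarith
  have "(s\<^sup>2 - (norm x)\<^sup>2) powr (\<mu> - 1/2) \<le> (s\<^sup>2 - (norm x)\<^sup>2) powr e"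
    unfolding e_def by (rule powr_mono') (use pos le1 in auto)
  also have "\<dots> = (s - norm x) powr e * (s + norm x) powr e"
    unfolding R by (rule powr_mult)
  also have "\<dots> \<le> (s - norm x) powr e * \<bar>x $ k\<bar> powr e"
    using xk by (intro mult_left_mono powr_mono2') (auto simp: e_def)
  finally have R_le: "(s\<^sup>2 - (norm x)\<^sup>2) powr (\<mu> - 1/2) \<le> (s - norm x) powr e * \<bar>x $ k\<bar> powr e" .
  have "y $ j \<le> 1" for j
  proof -
    have "y $ j \<le> csum y" using y by (intro le_csum) (simp add: less_imp_le)
    then show ?thesis using \<open>0 \<le> s\<close> by (simp add: s_def)
  qed
  then have y_le: "(\<Prod>j\<in>UNIV. y $ j powr \<kappa> $ j) \<le> (\<Prod>j\<in>UNIV. y $ j powr min (\<kappa> $ j) 0)"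
    using y by (intro prod_mono conjI powr_mono') (auto simp: less_imp_le)
  have "(\<Prod>i\<in>UNIV. \<bar>x $ i\<bar> powr (e * axis k 1 $ i)) = (\<Prod>i\<in>UNIV. if i = k then \<bar>x $ i\<bar> powr e else 1)"
    using x by (intro prod.cong) (auto simp: axis_def)
  then have mp: "monom_powr q (x, y) = \<bar>x $ k\<bar> powr e * (\<Prod>j\<in>UNIV. y $ j powr min (\<kappa> $ j) 0)"
    using y by (simp add: monom_powr_def prod_Basis_prod_vec q_def inner_axis less_imp_le)
  have "weight_BT \<mu> \<kappa> (x, y) \<le>
      (\<Prod>j\<in>UNIV. y $ j powr min (\<kappa> $ j) 0) * ((s - norm x) powr e * \<bar>x $ k\<bar> powr e)"
    unfolding weight_BT_def s_def[symmetric] prod.case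
    by (intro mult_mono y_le R_le prod_nonneg) auto
  then show ?thesis unfolding mp s_def by (simp add: mult_ac)
qed

lemma weight_BT_eq_0_if_norm_eq:
  assumes "(x, y) \<in> ball_simplex" "norm x = 1 - csum y"
  shows "weight_BT \<mu> \<kappa> (x, y) = 0"
  using assms by (simp add: weight_BT_def)

text \<open>
  On the domain, \<open>s - |x| = 1 - N\<close> for the homogeneous function \<open>N = |x| + sum_j |y_j|\<close>. The preceding
  bound is therefore a function of the form treated above, a product of powers of coordinates times
  a power of \<open>1 - N\<close>, and dilations reduce it to powers of coordinates on a cube. All exponents are
  greater than -1, so these integrals converge.
\<close>
lemma set_integrable_weight_BT:
  fixes \<kappa> :: "real^'n"
  assumes \<mu>: "\<mu> > -1/2" and \<kappa>: "\<And>j. \<kappa> $ j > -1"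
  shows "set_integrable lborel (ball_simplex :: ((real^'m) \<times> (real^'n)) set) (weight_BT \<mu> \<kappa>)"
proof -
  let ?\<Omega> = "ball_simplex :: ((real^'m) \<times> (real^'n)) set"
  fix k :: 'm
  define e where "e = min (\<mu> - 1/2) 0"
  define q :: "(real^'m) \<times> (real^'n)" where "q = (e *\<^sub>R axis k 1, \<chi> j. min (\<kappa> $ j) 0)"
  define N where "N = (\<lambda>p :: (real^'m) \<times> (real^'n). norm (fst p) + (\<Sum>j\<in>UNIV. \<bar>snd p $ j\<bar>))"
  have e: "-1 < e" "e \<le> 0" using \<mu> by (auto simp: e_def)
  have q: "-1 < q \<bullet> b" "q \<bullet> b \<le> 0" if "b \<in> Basis" for b
    using that e \<kappa> by (auto simp: Basis_prod_def Basis_vec_def q_def inner_axis) (auto simp: axis_def)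
  have "continuous_on UNIV N" unfolding N_def by (intro continuous_intros)
  then have [measurable]: "N \<in> borel_measurable borel" by (rule borel_measurable_continuous_onI)
  have N0: "0 \<le> N p" for p by (auto simp: N_def intro!: add_nonneg_nonneg sum_nonneg)
  have N_hom: "N (c *\<^sub>R p) = c * N p" if "c > 0" for c p
    using that by (simp add: N_def abs_mult sum_distrib_left algebra_simps)
  have N_coord: "\<bar>p \<bullet> b\<bar> \<le> N p" if "b \<in> Basis" for p b
  proof -
    have "\<bar>fst p $ i\<bar> \<le> N p" for i
      using component_le_norm_cart[of "fst p" i] unfolding N_def
      by (intro add_increasing2) (auto intro: sum_nonneg)
    moreover have "\<bar>snd p $ j\<bar> \<le> N p" for j
      using member_le_sum[of j UNIV "\<lambda>j. \<bar>snd p $ j\<bar>"] unfolding N_def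
      by (intro add_increasing) auto
    ultimately show ?thesis
      using that by (cases p) (auto simp: Basis_prod_def Basis_vec_def inner_axis)
  qed
  have w_hom: "monom_powr q (c *\<^sub>R p) \<le> monom_powr q p" if "c \<ge> 1" for c p
    unfolding monom_powr_def
  proof (intro prod_mono conjI)
    fix b :: "(real^'m) \<times> (real^'n)" assume b: "b \<in> Basis"
    have "c powr (q \<bullet> b) \<le> 1 powr (q \<bullet> b)"
      using that q[OF b] by (intro powr_mono2') auto
    then have "c powr (q \<bullet> b) * \<bar>p \<bullet> b\<bar> powr (q \<bullet> b) \<le> 1 * \<bar>p \<bullet> b\<bar> powr (q \<bullet> b)"
      by (intro mult_right_mono) auto
    then show "\<bar>c *\<^sub>R p \<bullet> b\<bar> powr (q \<bullet> b) \<le> \<bar>p \<bullet> b\<bar> powr (q \<bullet> b)"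
      using that by (simp add: abs_mult powr_mult)
  qed auto
  have "(\<integral>\<^sup>+p. ennreal (monom_powr q p * indicator {p. N p < 1} p) \<partial>lborel) \<le>
      (\<integral>\<^sup>+p. ennreal (monom_powr q p * indicator {p. \<forall>b\<in>Basis. \<bar>p \<bullet> b\<bar> \<le> 1} p) \<partial>lborel)"
    using N_coord by (intro nn_integral_mono ennreal_leI mult_left_mono monom_powr_nonneg)
      (auto simp: indicator_def intro: order.trans[OF N_coord])
  also have "\<dots> < \<infinity>"
    by (rule nn_integral_monom_powr_cube_finite) (rule q)
  finally have "(\<integral>\<^sup>+p. ennreal (monom_powr q p * (1 - N p) powr e * indicator {p. N p < 1} p) \<partial>lborel) < \<infinity>"
    by (intro nn_integral_radial_boundary_singularity_finite monom_powr_nonneg N0 N_hom w_hom e)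
       auto
  moreover have "(\<integral>\<^sup>+p. ennreal (indicator ?\<Omega> p * weight_BT \<mu> \<kappa> p) \<partial>lborel) \<le>
      (\<integral>\<^sup>+p. ennreal (monom_powr q p * (1 - N p) powr e * indicator {p. N p < 1} p) \<partial>lborel)"
  proof (rule nn_integral_mono_AE)
    have "AE p in lborel. \<forall>b\<in>Basis. p \<bullet> b \<noteq> (0 :: real)"
      by (intro AE_finite_allI finite_Basis AE_lborel_inner_neq)
    then show "AE p in lborel. ennreal (indicator ?\<Omega> p * weight_BT \<mu> \<kappa> p) \<le>
        ennreal (monom_powr q p * (1 - N p) powr e * indicator {p. N p < 1} p)"
    proof eventually_elim
      case (elim p)
      obtain x y where p: "p = (x, y)" by fastforce
      show ?case
      proof (cases "p \<in> ?\<Omega> \<and> norm x < 1 - csum y")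
        case True
        then have N: "N p = csum y + norm x" using p by (auto simp: N_def csum_def ball_simplex_iff)
        have "weight_BT \<mu> \<kappa> (x, y) \<le> monom_powr q (x, y) * (1 - csum y - norm x) powr e"
          unfolding q_def e_def by (rule weight_BT_le_monom_powr) (use True p elim in auto)
        then show ?thesis using True N p by (simp add: algebra_simps ennreal_leI)
      next
        case False
        then have "indicator ?\<Omega> p * weight_BT \<mu> \<kappa> p = 0"
          using weight_BT_eq_0_if_norm_eq[of x y] p by (force simp: indicator_def ball_simplex_iff)
        then show ?thesis by (simp only: ennreal_0 zero_le)
      qed
    qed
  qed
  ultimately have "(\<integral>\<^sup>+p. ennreal (indicator ?\<Omega> p * weight_BT \<mu> \<kappa> p) \<partial>lborel) < \<infinity>"
    by order
  moreover have "?\<Omega> \<in> sets borel" by (intro borel_closed compact_imp_closed compact_ball_simplex)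
  ultimately show ?thesis
    unfolding set_integrable_def
    by (intro integrableI_nonneg) (auto simp: weight_BT_nonneg)
qed

lemma set_integrable_mult_weight_BT:
  fixes \<kappa> :: "real^'n"
  assumes "\<mu> > -1/2" and "\<And>j. \<kappa> $ j > -1" and f: "continuous_on UNIV f"
  shows "set_integrable lborel (ball_simplex :: ((real^'m) \<times> (real^'n)) set) (\<lambda>p. f p * weight_BT \<mu> \<kappa> p)"
proof -
  let ?\<Omega> = "ball_simplex :: ((real^'m) \<times> (real^'n)) set"
  have "compact (f ` ?\<Omega>)"
    by (intro compact_continuous_image compact_ball_simplex continuous_on_subset[OF f]) auto
  then obtain B where B: "\<bar>f p\<bar> \<le> B" if "p \<in> ?\<Omega>" for p
    using compact_imp_bounded[of "f ` ?\<Omega>"] unfolding bounded_iff by auto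
  have [measurable]: "f \<in> borel_measurable borel" using f by (rule borel_measurable_continuous_onI)
  have [measurable]: "?\<Omega> \<in> sets borel" by (intro borel_closed compact_imp_closed compact_ball_simplex)
  have "set_integrable lborel ?\<Omega> (weight_BT \<mu> \<kappa>)"
    by (rule set_integrable_weight_BT) (rule assms)+
  then have int: "integrable lborel (\<lambda>p. B * (indicator ?\<Omega> p * weight_BT \<mu> \<kappa> p))"
    by (simp add: set_integrable_def)
  show ?thesis
    unfolding set_integrable_def
  proof (rule Bochner_Integration.integrable_bound[OF int])
    show "AE p in lborel. norm (indicator ?\<Omega> p *\<^sub>R (f p * weight_BT \<mu> \<kappa> p))
        \<le> norm (B * (indicator ?\<Omega> p * weight_BT \<mu> \<kappa> p))"
    proof (rule AE_I2)
      fix p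
      have "\<bar>f p\<bar> * weight_BT \<mu> \<kappa> p \<le> \<bar>B\<bar> * weight_BT \<mu> \<kappa> p" if "p \<in> ?\<Omega>"
        using B[OF that] by (intro mult_right_mono weight_BT_nonneg) auto
      then show "norm (indicator ?\<Omega> p *\<^sub>R (f p * weight_BT \<mu> \<kappa> p))
          \<le> norm (B * (indicator ?\<Omega> p * weight_BT \<mu> \<kappa> p))"
        using weight_BT_nonneg[of \<mu> \<kappa> p] by (auto simp: abs_mult indicator_def)
    qed
  qed measurable
qed

section \<open>The weight in the interior of the domain\<close>

definition ball_simplex_interior :: "((real^'m) \<times> (real^'n)) set" where
  "ball_simplex_interior = {(x, y). (\<forall>j. 0 < y $ j) \<and> norm x < 1 - csum y}"

lemma ball_simplex_interior_subset: "ball_simplex_interior \<subseteq> ball_simplex"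
  by (auto simp: ball_simplex_interior_def ball_simplex_iff less_imp_le)

lemma open_ball_simplex_interior:
  "open (ball_simplex_interior :: ((real^'m) \<times> (real^'n)) set)"
proof -
  have eq: "(ball_simplex_interior :: ((real^'m) \<times> (real^'n)) set) =
      (\<Inter>j. {p. 0 < snd p $ j}) \<inter> {p. norm (fst p) < 1 - csum (snd p)}"
    by (auto simp: ball_simplex_interior_def)
  show ?thesis
    unfolding eq by (intro open_Int open_INT ballI open_Collect_less continuous_intros) auto
qed

lemma ball_simplex_interior_nonempty: "(ball_simplex_interior :: ((real^'m) \<times> (real^'n)) set) \<noteq> {}"
proof -
  have "(0, \<chi> j. 1 / (2 * real CARD('n))) \<in> (ball_simplex_interior :: ((real^'m) \<times> (real^'n)) set)"
    by (simp add: ball_simplex_interior_def csum_def)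
  then show ?thesis by blast
qed

definition radicand :: "(real^'m) \<times> (real^'n) \<Rightarrow> real" where
  "radicand p = (1 - csum (snd p))\<^sup>2 - (norm (fst p))\<^sup>2"

lemma weight_BT_eq: "weight_BT \<mu> \<kappa> p = (\<Prod>j\<in>UNIV. snd p $ j powr \<kappa> $ j) * radicand p powr (\<mu> - 1/2)"
  by (simp add: weight_BT_def radicand_def case_prod_unfold)

lemma interior_pos:
  assumes "p \<in> ball_simplex_interior"
  shows "0 < snd p $ j" "0 < radicand p"
proof -
  show "0 < snd p $ j" using assms by (auto simp: ball_simplex_interior_def)
  have "norm (fst p) < 1 - csum (snd p)" using assms by (auto simp: ball_simplex_interior_def)
  then show "0 < radicand p" by (simp add: radicand_def power_strict_mono)
qed

lemma weight_BT_pos: "p \<in> ball_simplex_interior \<Longrightarrow> 0 < weight_BT \<mu> \<kappa> p"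
  using interior_pos[of p] by (auto simp: weight_BT_eq intro!: mult_pos_pos prod_pos)
    (auto simp: less_le)

text \<open>
  The convention \<open>0 powr a = 0\<close> makes the weight vanish on the boundary for every choice of the
  exponents, so integrals over the domain and over its interior agree exactly.
\<close>
lemma weight_BT_eq_0_on_boundary:
  assumes "p \<in> ball_simplex" "p \<notin> ball_simplex_interior"
  shows "weight_BT \<mu> \<kappa> p = 0"
proof -
  obtain x y where p: "p = (x, y)" by fastforce
  show ?thesis
  proof (cases "\<exists>j. y $ j = 0")
    case True
    then show ?thesis by (auto simp: p weight_BT_def intro: prod_zero)
  next
    case False
    with assms have "norm x = 1 - csum y"
      by (auto simp: p ball_simplex_interior_def ball_simplex_iff less_le)
    with assms show ?thesis by (simp add: p weight_BT_eq_0_if_norm_eq)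
  qed
qed

lemma set_integral_ball_simplex_eq_interior:
  "(LINT p:ball_simplex|lborel. f p * weight_BT \<mu> \<kappa> p) =
    (LINT p:ball_simplex_interior|lborel. f p * weight_BT \<mu> \<kappa> p)"
  unfolding set_lebesgue_integral_def
  using ball_simplex_interior_subset weight_BT_eq_0_on_boundary[of _ \<mu> \<kappa>]
  by (intro Bochner_Integration.integral_cong refl) (auto simp: indicator_def)

text \<open>
  The coordinate directions, indexed so that sums over \<open>x\<close>- and \<open>y\<close>-coordinates become one sum.
\<close>
definition dirs :: "'m + 'n \<Rightarrow> (real^'m) \<times> (real^'n)" where
  "dirs k = (case k of Inl i \<Rightarrow> (axis i 1, 0) | Inr j \<Rightarrow> (0, axis j 1))"

lemma sum_UNIV_Plus:
  fixes f :: "'m::finite + 'n::finite \<Rightarrow> 'a::comm_monoid_add"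
  shows "(\<Sum>k\<in>UNIV. f k) = (\<Sum>i\<in>UNIV. f (Inl i)) + (\<Sum>j\<in>UNIV. f (Inr j))"
  by (simp add: UNIV_Plus_UNIV[symmetric] sum.Plus del: UNIV_Plus_UNIV)

text \<open>
  The derivative of the logarithm of the weight in the direction \<open>dirs k\<close>.
\<close>
definition log_grad :: "real \<Rightarrow> real^'n \<Rightarrow> 'm + 'n \<Rightarrow> (real^'m) \<times> (real^'n) \<Rightarrow> real" where
  "log_grad \<mu> \<kappa> k p = (case k of
     Inl i \<Rightarrow> - (2 * \<mu> - 1) * fst p $ i / radicand p
   | Inr j \<Rightarrow> \<kappa> $ j / snd p $ j - (2 * \<mu> - 1) * (1 - csum (snd p)) / radicand p)"

lemma powr_has_logarithmic_derivative:
  fixes f :: "real \<Rightarrow> real"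
  assumes "(f has_real_derivative f') (at t)" "f t > 0"
  shows "((\<lambda>t. f t powr a) has_real_derivative f t powr a * (a * f' / f t)) (at t)"
  by (rule DERIV_cong[OF DERIV_fun_powr[OF assms]]) (use assms(2) in \<open>simp add: powr_diff\<close>)

lemma weight_BT_has_derivative:
  fixes p :: "(real^'m) \<times> (real^'n)"
  assumes p: "p \<in> ball_simplex_interior"
  shows "((\<lambda>t. weight_BT \<mu> \<kappa> (p + t *\<^sub>R dirs k)) has_real_derivative
    weight_BT \<mu> \<kappa> p * log_grad \<mu> \<kappa> k p) (at 0)"
proof (cases k)
  case (Inl i)
  have R: "((\<lambda>t. radicand (p + t *\<^sub>R dirs k)) has_real_derivative - 2 * fst p $ i) (at 0)"
    unfolding radicand_def power2_norm_eq_inner Inl dirs_def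
    by (auto intro!: derivative_eq_intros simp: inner_add_left inner_add_right inner_axis inner_axis')
  have R0: "radicand (p + 0 *\<^sub>R dirs k) > 0" using interior_pos(2)[OF p] by simp
  have Q: "(\<Prod>j\<in>UNIV. snd (p + t *\<^sub>R dirs k) $ j powr \<kappa> $ j) = (\<Prod>j\<in>UNIV. snd p $ j powr \<kappa> $ j)" for t
    by (simp add: Inl dirs_def)
  show ?thesis
    unfolding weight_BT_eq Q
    by (rule DERIV_cong[OF DERIV_cmult[OF powr_has_logarithmic_derivative[OF R R0]]])
       (simp add: Inl log_grad_def algebra_simps)
next
  case (Inr j)
  have cs: "csum (snd p + t *\<^sub>R axis j 1) = csum (snd p) + t" for t
  proof -
    have "csum (snd p + t *\<^sub>R axis j 1) = csum (snd p) + (\<Sum>l\<in>UNIV. t * axis j 1 $ l)"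
      by (simp add: csum_def sum.distrib)
    then show ?thesis by (simp add: axis_def if_distrib cong: if_cong)
  qed
  have R: "((\<lambda>t. radicand (p + t *\<^sub>R dirs k)) has_real_derivative - 2 * (1 - csum (snd p))) (at 0)"
    unfolding radicand_def Inr dirs_def by (auto simp: cs intro!: derivative_eq_intros)
  have pos: "radicand (p + 0 *\<^sub>R dirs k) > 0" "snd p $ j + 0 > 0"
    using interior_pos[OF p] by simp_all
  have "((\<lambda>t. snd p $ j + t) has_real_derivative 1) (at 0)"
    by (auto intro!: derivative_eq_intros)
  note D2 = powr_has_logarithmic_derivative[OF this pos(2), of "\<kappa> $ j"]
  note D1 = powr_has_logarithmic_derivative[OF R pos(1), of "\<mu> - 1/2"]
  define Q where "Q = (\<Prod>l\<in>UNIV - {j}. snd p $ l powr \<kappa> $ l)"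
  have Q: "(\<Prod>l\<in>UNIV. snd (p + t *\<^sub>R dirs k) $ l powr \<kappa> $ l) = Q * (snd p $ j + t) powr \<kappa> $ j" for t
  proof -
    have "(\<Prod>l\<in>UNIV - {j}. snd (p + t *\<^sub>R dirs k) $ l powr \<kappa> $ l) = Q"
      unfolding Q_def by (intro prod.cong) (auto simp: Inr dirs_def axis_def)
    then show ?thesis
      by (simp add: prod.remove[of UNIV j] Inr dirs_def)
  qed
  have Q0: "(\<Prod>l\<in>UNIV. snd p $ l powr \<kappa> $ l) = Q * (snd p $ j) powr \<kappa> $ j"
    using Q[of 0] by simp
  show ?thesis
    unfolding weight_BT_eq Q Q0
    by (rule DERIV_cong[OF DERIV_mult[OF DERIV_cmult[OF D2, of Q] D1]])
       (simp add: Inr log_grad_def algebra_simps add_divide_distrib diff_divide_distrib)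
qed

lemma continuous_on_radicand [continuous_intros]: "continuous_on S radicand"
  unfolding radicand_def[abs_def] by (intro continuous_intros)

lemma continuous_on_weight_BT:
  "continuous_on ball_simplex_interior (weight_BT \<mu> (\<kappa> :: real^'n) :: (real^'m) \<times> _ \<Rightarrow> _)"
  unfolding weight_BT_eq[abs_def]
  by (intro continuous_intros) (auto dest: interior_pos simp: less_le)

lemma continuous_on_log_grad:
  "continuous_on ball_simplex_interior (log_grad \<mu> (\<kappa> :: real^'n) k :: (real^'m) \<times> _ \<Rightarrow> _)"
proof (cases k)
  case (Inl i)
  show ?thesis unfolding log_grad_def[abs_def] Inl sum.case
    by (intro continuous_intros) (auto dest: interior_pos simp: less_le)
next
  case (Inr j)
  show ?thesis unfolding log_grad_def[abs_def] Inr sum.case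
    by (intro continuous_intros) (auto dest: interior_pos simp: less_le)
qed

text \<open>
  The weight with all exponents equal to 1, that is \<open>y_1 \<dots> y_d ((1 - |y|)^2 - |x|^2)\<close>, serves as the
  boundary function of the domain. Having it in the same family as the actual weight means that one
  computation of logarithmic derivatives covers both.
\<close>
lemma compact_superlevel_boundary_function:
  assumes "\<epsilon> > 0"
  shows "compact {p \<in> (ball_simplex_interior :: ((real^'m) \<times> (real^'n)) set). \<epsilon> \<le> weight_BT (3/2) 1 p}"
proof -
  define r where "r = (\<lambda>p :: (real^'m) \<times> (real^'n). (\<Prod>j\<in>UNIV. snd p $ j) * radicand p)"
  have r: "weight_BT (3/2) 1 p = r p" if p: "p \<in> ball_simplex" for p :: "(real^'m) \<times> (real^'n)"
  proof -
    have "norm (fst p) \<le> 1 - csum (snd p)" "\<And>j. 0 \<le> snd p $ j"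
      using p by (cases p, auto simp: ball_simplex_iff)+
    then show ?thesis
      by (simp add: weight_BT_eq r_def radicand_def power_mono)
  qed
  have "{p \<in> ball_simplex_interior. \<epsilon> \<le> weight_BT (3/2) 1 p} = ball_simplex \<inter> {p. \<epsilon> \<le> r p}"
    using assms weight_BT_eq_0_on_boundary[of _ "3/2" 1] ball_simplex_interior_subset r by fastforce
  moreover have "closed {p. \<epsilon> \<le> r p}"
    unfolding r_def by (intro closed_Collect_le continuous_intros)
  ultimately show ?thesis by (simp add: compact_Int_closed compact_ball_simplex)
qed

lemma real_polynomial_function_continuous_on:
  "real_polynomial_function f \<Longrightarrow> continuous_on S (f :: 'a::euclidean_space \<Rightarrow> real)"
  by (simp add: continuous_on_polymonial_function real_polynomial_function_eq)

lemma real_polynomial_function_dir_deriv: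
  "real_polynomial_function f \<Longrightarrow> real_polynomial_function (dir_deriv v (f :: 'a::euclidean_space \<Rightarrow> real))"
  using polys_upto_dir_deriv real_polynomial_function_iff by blast

text \<open>
  For a polynomial field \<open>f\<close>, the divergence of \<open>W f\<close> is \<open>W\<close> times \<open>div f + f \<cdot> grad (log W)\<close>. Both
  hypotheses ask that poles of a logarithmic gradient cancel: for \<open>W\<close> this gives an integrable
  divergence, and for the boundary function it is tangency of \<open>f\<close> to all faces.
\<close>
lemma integral_weighted_divergence_eq_0:
  fixes f :: "'m + 'n \<Rightarrow> (real^'m) \<times> (real^'n) \<Rightarrow> real"
  assumes \<mu>: "\<mu> > - 1/2" and \<kappa>: "\<And>j. \<kappa> $ j > -1"
    and f: "\<And>k. real_polynomial_function (f k)"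
    and h: "continuous_on UNIV h"
    and c: "continuous_on UNIV c"
    and div: "\<And>p. p \<in> ball_simplex_interior \<Longrightarrow>
      (\<Sum>k\<in>UNIV. dir_deriv (dirs k) (f k) p + f k p * log_grad \<mu> \<kappa> k p) = h p"
    and tangent: "\<And>p. p \<in> ball_simplex_interior \<Longrightarrow>
      (\<Sum>k\<in>UNIV. f k p * log_grad (3/2) 1 k p) = c p"
  shows "(LINT p:ball_simplex|lborel. h p * weight_BT \<mu> \<kappa> p) = 0"
proof -
  let ?U = "ball_simplex_interior :: ((real^'m) \<times> (real^'n)) set"
  let ?W = "weight_BT \<mu> \<kappa> :: (real^'m) \<times> (real^'n) \<Rightarrow> real"
  let ?\<rho> = "weight_BT (3/2) 1 :: (real^'m) \<times> (real^'n) \<Rightarrow> real"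
  have int: "set_integrable lborel ?U (\<lambda>p. a p * ?W p)" if "continuous_on UNIV a" for a
    by (rule set_integrable_subset[OF set_integrable_mult_weight_BT[OF \<mu> \<kappa> that]
          _ ball_simplex_interior_subset])
       (simp add: open_ball_simplex_interior)
  have "(LINT p:?U|lborel. h p * ?W p) = 0"
  proof (rule integral_divergence_tangential_eq_0[where I = UNIV and v = dirs and \<rho> = ?\<rho>
        and d\<rho> = "\<lambda>k p. ?\<rho> p * log_grad (3/2) 1 k p" and G = "\<lambda>k p. ?W p * f k p"
        and dG = "\<lambda>k p. ?W p * dir_deriv (dirs k) (f k) p + ?W p * log_grad \<mu> \<kappa> k p * f k p"
        and C = "\<lambda>p. \<bar>c p\<bar> * ?W p"])
    show "open ?U" by (rule open_ball_simplex_interior)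
    show "compact {p \<in> ?U. \<epsilon> \<le> ?\<rho> p}" if "\<epsilon> > 0" for \<epsilon>
      using that by (rule compact_superlevel_boundary_function)
    show "?\<rho> p > 0" if "p \<in> ?U" for p using that by (rule weight_BT_pos)
    show "((\<lambda>t. ?\<rho> (p + t *\<^sub>R dirs k)) has_real_derivative ?\<rho> p * log_grad (3/2) 1 k p) (at 0)"
      if "p \<in> ?U" for k p
      using that by (rule weight_BT_has_derivative)
    show "((\<lambda>t. ?W (p + t *\<^sub>R dirs k) * f k (p + t *\<^sub>R dirs k)) has_real_derivative
        ?W p * dir_deriv (dirs k) (f k) p + ?W p * log_grad \<mu> \<kappa> k p * f k p) (at 0)"
      if "p \<in> ?U" for k p
      using DERIV_mult'[OF weight_BT_has_derivative[OF that] dir_deriv_has_derivative(1)[OF f]]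
      by simp
    show "(\<Sum>k\<in>UNIV. ?W p * dir_deriv (dirs k) (f k) p + ?W p * log_grad \<mu> \<kappa> k p * f k p) = h p * ?W p"
      if "p \<in> ?U" for p
      using div[OF that, symmetric] by (simp add: sum_distrib_left sum_distrib_right algebra_simps)
    show "\<bar>\<Sum>k\<in>UNIV. ?W p * f k p * (?\<rho> p * log_grad (3/2) 1 k p)\<bar> \<le> \<bar>c p\<bar> * ?W p * ?\<rho> p"
      if "p \<in> ?U" for p
    proof -
      have "(\<Sum>k\<in>UNIV. ?W p * f k p * (?\<rho> p * log_grad (3/2) 1 k p)) = c p * (?W p * ?\<rho> p)"
        using tangent[OF that, symmetric] by (simp add: sum_distrib_left sum_distrib_right algebra_simps)
      then show ?thesis by (simp add: abs_mult weight_BT_nonneg)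
    qed
    show "continuous_on ?U ?\<rho>" by (rule continuous_on_weight_BT)
    show "continuous_on ?U (\<lambda>p. ?\<rho> p * log_grad (3/2) 1 k p)" for k
      by (intro continuous_on_mult continuous_on_weight_BT continuous_on_log_grad)
    show "continuous_on ?U (\<lambda>p. ?W p * f k p)" for k
      by (intro continuous_on_mult continuous_on_weight_BT real_polynomial_function_continuous_on f)
    show "continuous_on ?U (\<lambda>p. ?W p * dir_deriv (dirs k) (f k) p + ?W p * log_grad \<mu> \<kappa> k p * f k p)" for k
      by (intro continuous_on_add continuous_on_mult continuous_on_weight_BT continuous_on_log_grad
          real_polynomial_function_continuous_on real_polynomial_function_dir_deriv f)
    show "set_integrable lborel ?U (\<lambda>p. h p * ?W p)" by (rule int) (rule h)
    show "set_integrable lborel ?U (\<lambda>p. \<bar>c p\<bar> * ?W p)"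
      by (rule int) (intro continuous_intros c)
  qed simp_all
  then show ?thesis by (simp add: set_integral_ball_simplex_eq_interior)
qed

section \<open>Symmetry of the differential operator\<close>

text \<open>
  The Euler operator is differentiation in the direction of the position vector.
\<close>
lemma euler_op_eq_dir_deriv:
  fixes u :: "(real^'m) \<times> (real^'n) \<Rightarrow> real"
  assumes "real_polynomial_function u"
  shows "euler_op u p = dir_deriv p u p"
proof -
  obtain x y where p: "p = (x, y)" by fastforce
  interpret D: bounded_linear "\<lambda>v. dir_deriv v u p"
    using dir_deriv_has_derivative(2)[OF assms] by (rule has_derivative_bounded_linear)
  have vec: "z = (\<Sum>i\<in>UNIV. z $ i *\<^sub>R axis i 1)" for z :: "real^'k"
    by (simp add: vec_eq_iff axis_def if_distrib cong: if_cong)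
  have "x = (\<Sum>i\<in>UNIV. x $ i *\<^sub>R axis i 1)" "y = (\<Sum>j\<in>UNIV. y $ j *\<^sub>R axis j 1)"
    by (rule vec)+
  then have "p = (\<Sum>i\<in>UNIV. x $ i *\<^sub>R (axis i 1, 0)) + (\<Sum>j\<in>UNIV. y $ j *\<^sub>R (0, axis j 1))"
    by (simp add: p prod_eq_iff fst_sum snd_sum)
  from arg_cong[OF this, of "\<lambda>v. dir_deriv v u p"]
  have "dir_deriv p u p = (\<Sum>i\<in>UNIV. x $ i * dir_deriv (axis i 1, 0) u p)
      + (\<Sum>j\<in>UNIV. y $ j * dir_deriv (0, axis j 1) u p)"
    by (simp only: D.add D.sum D.scaleR real_scaleR_def)
  then show ?thesis by (simp add: euler_op_def dx_def dy_def p)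
qed

lemma polys_upto_euler_op:
  assumes "u \<in> polys_upto n"
  shows "(\<lambda>p. euler_op u p - real n * u p) \<in> polys_upto (n - 1)"
    and "euler_op u \<in> polys_upto n"
proof -
  have eq: "euler_op u = (\<lambda>p. dir_deriv p u p)"
    by (rule ext) (rule euler_op_eq_dir_deriv[OF polys_upto_real_polynomial_function[OF assms]])
  show *: "(\<lambda>p. euler_op u p - real n * u p) \<in> polys_upto (n - 1)"
    unfolding eq using polys_upto_euler[OF assms] by blast
  from polys_upto_add[OF polys_upto_mono[OF _ *] polys_upto_cmult[OF assms, of "real n"]]
  show "euler_op u \<in> polys_upto n" by simp
qed

lemma real_polynomial_function_euler_op:
  "real_polynomial_function u \<Longrightarrow> real_polynomial_function (euler_op u)"
  using polys_upto_euler_op(2) real_polynomial_function_iff by blast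

text \<open>
  The field \<open>M grad u\<close>, where \<open>M\<close> is the symmetric matrix with blocks \<open>(1 - |y|) \<delta> - x_i x_k\<close>,
  \<open>- x_i y_j\<close> and \<open>y_j \<delta> - y_j y_l\<close> formed by the second-order coefficients of the operator.
\<close>
definition flux :: "((real^'m) \<times> (real^'n) \<Rightarrow> real) \<Rightarrow> 'm + 'n \<Rightarrow> (real^'m) \<times> (real^'n) \<Rightarrow> real" where
  "flux u k p = (case k of
     Inl i \<Rightarrow> (1 - csum (snd p)) * dx i u p - fst p $ i * euler_op u p
   | Inr j \<Rightarrow> snd p $ j * (dy j u p - euler_op u p))"

lemma euler_op_split: "euler_op u p = (\<Sum>i\<in>UNIV. fst p $ i * dx i u p) + (\<Sum>j\<in>UNIV. snd p $ j * dy j u p)"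
  by (simp add: euler_op_def case_prod_unfold)

text \<open>
  The poles of the logarithmic gradient cancel against \<open>M\<close>. With \<open>R\<close> the radicand and \<open>z = (x, y)\<close> one has
  \<open>M grad R = - 2 R z\<close> and \<open>M grad y_j = y_j (e_j - z)\<close>, so dividing by \<open>R\<close> and by \<open>y_j\<close> leaves
  polynomials. Geometrically, \<open>M grad u\<close> is tangent to the cone \<open>R = 0\<close> and to the faces \<open>y_j = 0\<close>.
\<close>
lemma sum_flux_log_grad:
  fixes u :: "(real^'m) \<times> (real^'n) \<Rightarrow> real"
  assumes p: "p \<in> ball_simplex_interior"
  shows "(\<Sum>k\<in>UNIV. flux u k p * log_grad \<mu> \<kappa> k p) =
    (\<Sum>j\<in>UNIV. \<kappa> $ j * dy j u p) - (csum \<kappa> + 2 * \<mu> - 1) * euler_op u p"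
proof -
  define s where "s = 1 - csum (snd p)"
  define R where "R = radicand p"
  define E where "E = euler_op u p"
  define Ex where "Ex = (\<Sum>i\<in>UNIV. fst p $ i * dx i u p)"
  define Ey where "Ey = (\<Sum>j\<in>UNIV. snd p $ j * dy j u p)"
  have E: "E = Ex + Ey" by (simp add: E_def Ex_def Ey_def euler_op_split)
  have "(norm (fst p))\<^sup>2 = (\<Sum>i\<in>UNIV. (fst p $ i)\<^sup>2)"
    by (simp only: power2_norm_eq_inner inner_vec_def) (simp add: power2_eq_square)
  then have R: "R = s\<^sup>2 - (\<Sum>i\<in>UNIV. (fst p $ i)\<^sup>2)" "R \<noteq> 0"
    using interior_pos(2)[OF p] by (simp_all add: R_def s_def radicand_def)
  have "(\<Sum>i\<in>UNIV. flux u (Inl i) p * log_grad \<mu> \<kappa> (Inl i) p) =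
      (\<Sum>i\<in>UNIV. - (2 * \<mu> - 1) / R * (s * (fst p $ i * dx i u p) - (fst p $ i)\<^sup>2 * E))"
    by (intro sum.cong refl)
       (simp add: flux_def log_grad_def s_def R_def E_def power2_eq_square algebra_simps
          add_divide_distrib diff_divide_distrib)
  also have "\<dots> = - (2 * \<mu> - 1) / R * (s * Ex - (s\<^sup>2 - R) * E)"
  proof -
    have "(\<Sum>i\<in>UNIV. s * (fst p $ i * dx i u p) - (fst p $ i)\<^sup>2 * E) = s * Ex - (s\<^sup>2 - R) * E"
      by (simp add: R(1) Ex_def sum_subtractf sum_distrib_left sum_distrib_right)
    then show ?thesis by (simp only: sum_distrib_left[symmetric])
  qed
  finally have x: "(\<Sum>i\<in>UNIV. flux u (Inl i) p * log_grad \<mu> \<kappa> (Inl i) p) =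
      - (2 * \<mu> - 1) / R * (s * Ex - (s\<^sup>2 - R) * E)" .
  have "(\<Sum>j\<in>UNIV. flux u (Inr j) p * log_grad \<mu> \<kappa> (Inr j) p) =
      (\<Sum>j\<in>UNIV. (\<kappa> $ j * dy j u p - \<kappa> $ j * E)
        - (2 * \<mu> - 1) * s / R * (snd p $ j * dy j u p - snd p $ j * E))"
  proof (intro sum.cong refl)
    fix j
    have "snd p $ j \<noteq> 0" using interior_pos(1)[OF p, of j] by simp
    then show "flux u (Inr j) p * log_grad \<mu> \<kappa> (Inr j) p = (\<kappa> $ j * dy j u p - \<kappa> $ j * E)
        - (2 * \<mu> - 1) * s / R * (snd p $ j * dy j u p - snd p $ j * E)"
      by (simp add: flux_def log_grad_def s_def R_def E_def algebra_simps
          add_divide_distrib diff_divide_distrib)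
  qed
  also have "\<dots> = (\<Sum>j\<in>UNIV. \<kappa> $ j * dy j u p) - csum \<kappa> * E - (2 * \<mu> - 1) * s / R * (Ey - (1 - s) * E)"
  proof -
    have "(\<Sum>j\<in>UNIV. snd p $ j * dy j u p - snd p $ j * E) = Ey - (1 - s) * E"
      by (simp add: Ey_def s_def csum_def sum_subtractf sum_distrib_right)
    then show ?thesis
      by (simp only: sum_subtractf sum_distrib_left[symmetric] sum_distrib_right[symmetric] csum_def)
  qed
  finally have y: "(\<Sum>j\<in>UNIV. flux u (Inr j) p * log_grad \<mu> \<kappa> (Inr j) p) =
      (\<Sum>j\<in>UNIV. \<kappa> $ j * dy j u p) - csum \<kappa> * E - (2 * \<mu> - 1) * s / R * (Ey - (1 - s) * E)" .
  have "- (2 * \<mu> - 1) / R * (s * Ex - (s\<^sup>2 - R) * E) - (2 * \<mu> - 1) * s / R * (Ey - (1 - s) * E)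
      = - (2 * \<mu> - 1) / R * (s * Ex - (s\<^sup>2 - R) * E + s * (Ey - (1 - s) * E))"
    by (simp add: algebra_simps diff_divide_distrib add_divide_distrib)
  also have "s * Ex - (s\<^sup>2 - R) * E + s * (Ey - (1 - s) * E) = R * E"
    unfolding E by (simp add: power2_eq_square algebra_simps)
  finally have "- (2 * \<mu> - 1) / R * (s * Ex - (s\<^sup>2 - R) * E) - (2 * \<mu> - 1) * s / R * (Ey - (1 - s) * E)
      = - (2 * \<mu> - 1) * E" using R(2) by simp
  then show ?thesis
    unfolding sum_UNIV_Plus x y E_def[symmetric] by (simp add: algebra_simps)
qed

lemma real_polynomial_function_fst: "real_polynomial_function (\<lambda>p. fst p $ i)"
  by (rule real_polynomial_function.intros(1))
     (rule bounded_linear_compose[OF bounded_linear_vec_nth bounded_linear_fst])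

lemma real_polynomial_function_snd: "real_polynomial_function (\<lambda>p. snd p $ j)"
  by (rule real_polynomial_function.intros(1))
     (rule bounded_linear_compose[OF bounded_linear_vec_nth bounded_linear_snd])

lemma real_polynomial_function_slack: "real_polynomial_function (\<lambda>p. 1 - csum (snd p))"
  unfolding csum_def
  by (intro real_polynomial_function_diff real_polynomial_function.intros(2) real_polynomial_function_sum
      real_polynomial_function_snd) auto

lemma real_polynomial_function_dx: "real_polynomial_function u \<Longrightarrow> real_polynomial_function (dx i u)"
  unfolding dx_def by (rule real_polynomial_function_dir_deriv)

lemma real_polynomial_function_dy: "real_polynomial_function u \<Longrightarrow> real_polynomial_function (dy j u)"
  unfolding dy_def by (rule real_polynomial_function_dir_deriv)

lemmas real_polynomial_function_closure =
  real_polynomial_function_fst real_polynomial_function_snd real_polynomial_function_slack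
  real_polynomial_function_dx real_polynomial_function_dy real_polynomial_function_euler_op
  real_polynomial_function.intros(2-4)
  real_polynomial_function_diff real_polynomial_function_sum

lemma dx_dy_rules:
  fixes f g :: "(real^'m) \<times> (real^'n) \<Rightarrow> real"
  assumes "real_polynomial_function f" "real_polynomial_function g"
  shows "dx i (\<lambda>p. f p * g p) p = f p * dx i g p + dx i f p * g p"
    and "dy j (\<lambda>p. f p * g p) p = f p * dy j g p + dy j f p * g p"
    and "dx i (\<lambda>p. f p - g p) p = dx i f p - dx i g p"
    and "dy j (\<lambda>p. f p - g p) p = dy j f p - dy j g p"
  unfolding dx_def dy_def
  by (simp_all only: dir_deriv_mult[OF assms] dir_deriv_diff[OF assms])

lemma dx_dy_linear:
  fixes p :: "(real^'m) \<times> (real^'n)"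
  shows "dx i (\<lambda>p. 1 - csum (snd p)) p = 0" "dx i (\<lambda>p. fst p $ i) p = 1" "dy j (\<lambda>p. snd p $ j) p = 1"
proof -
  have 3: "((\<lambda>p. snd p $ j) has_derivative (\<lambda>v. snd v $ j)) (at p)" for j
    by (intro bounded_linear_imp_has_derivative
        bounded_linear_compose[OF bounded_linear_vec_nth bounded_linear_snd])
  have sum: "((\<lambda>p. \<Sum>j\<in>UNIV. snd p $ j) has_derivative (\<lambda>v. \<Sum>j\<in>UNIV. snd v $ j)) (at p)"
    by (rule has_derivative_sum) (rule 3)
  have 1: "((\<lambda>p. 1 - csum (snd p)) has_derivative (\<lambda>v. - csum (snd v))) (at p)"
    unfolding csum_def
    using has_derivative_diff[OF has_derivative_const[of 1] sum] by simp
  show "dx i (\<lambda>p. 1 - csum (snd p)) p = 0"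
    unfolding dx_def dir_deriv_eq(1)[OF 1] by (simp add: csum_def)
  have 2: "((\<lambda>p. fst p $ i) has_derivative (\<lambda>v. fst v $ i)) (at p)"
    by (intro bounded_linear_imp_has_derivative
        bounded_linear_compose[OF bounded_linear_vec_nth bounded_linear_fst])
  show "dx i (\<lambda>p. fst p $ i) p = 1"
    unfolding dx_def dir_deriv_eq(1)[OF 2] by simp
  show "dy j (\<lambda>p. snd p $ j) p = 1"
    unfolding dy_def dir_deriv_eq(1)[OF 3] by simp
qed

lemma dir_deriv_dirs: "dir_deriv (dirs (Inl i)) = dx i" "dir_deriv (dirs (Inr j)) = dy j"
  by (simp_all add: dirs_def dx_def dy_def)

lemma real_polynomial_function_flux:
  assumes "real_polynomial_function u"
  shows "real_polynomial_function (flux u k)"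
  unfolding flux_def[abs_def] by (cases k) (auto intro!: real_polynomial_function_closure assms)

lemma funpow_2_apply: "(f ^^ 2) x = f (f x)"
  by (simp add: numeral_2_eq_2)

text \<open>
  The derivatives fall on \<open>euler_op u\<close> as a whole, which is what produces the square of the Euler
  operator without interchanging any partial derivatives.
\<close>
lemma sum_dir_deriv_flux:
  fixes u :: "(real^'m) \<times> (real^'n) \<Rightarrow> real"
  assumes u: "real_polynomial_function u"
  shows "(\<Sum>k\<in>UNIV. dir_deriv (dirs k) (flux u k) p) =
    (1 - csum (snd p)) * laplace_x u p - (euler_op ^^ 2) u p
    + (\<Sum>j\<in>UNIV. snd p $ j * ((dy j) ^^ 2) u p + dy j u p)
    - (real CARD('m) + real CARD('n)) * euler_op u p"
proof -
  have x: "dx i (flux u (Inl i)) p = (1 - csum (snd p)) * dx i (dx i u) p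
      - (fst p $ i * dx i (euler_op u) p + euler_op u p)" for i
  proof -
    have "flux u (Inl i) = (\<lambda>p. (1 - csum (snd p)) * dx i u p - fst p $ i * euler_op u p)"
      by (simp add: flux_def fun_eq_iff)
    then show ?thesis
      by (simp add: dx_dy_rules(1,3) dx_dy_linear real_polynomial_function_closure u)
  qed
  have y: "dy j (flux u (Inr j)) p = snd p $ j * dy j (dy j u) p + dy j u p
      - (snd p $ j * dy j (euler_op u) p + euler_op u p)" for j
  proof -
    have "flux u (Inr j) = (\<lambda>p. snd p $ j * (dy j u p - euler_op u p))"
      by (simp add: flux_def fun_eq_iff)
    then show ?thesis
      by (simp add: dx_dy_rules(2,4) dx_dy_linear real_polynomial_function_closure u algebra_simps)
  qed
  have "(\<Sum>k\<in>UNIV. dir_deriv (dirs k) (flux u k) p) =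
      (\<Sum>i\<in>UNIV. dx i (flux u (Inl i)) p) + (\<Sum>j\<in>UNIV. dy j (flux u (Inr j)) p)"
    by (simp add: sum_UNIV_Plus dir_deriv_dirs)
  then show ?thesis
    unfolding x y
    by (simp add: sum_subtractf sum.distrib laplace_x_def funpow_2_apply euler_op_split[of "euler_op u"]
        sum_distrib_left algebra_simps)
qed

text \<open>
  The operator is in divergence form: \<open>W D u = div (W M grad u)\<close>.
\<close>
lemma diff_op_BT_eq_divergence:
  fixes u :: "(real^'m) \<times> (real^'n) \<Rightarrow> real"
  assumes u: "real_polynomial_function u" and p: "p \<in> ball_simplex_interior"
  shows "(\<Sum>k\<in>UNIV. dir_deriv (dirs k) (flux u k) p + flux u k p * log_grad \<mu> \<kappa> k p) = diff_op_BT \<mu> \<kappa> u p"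
  unfolding sum.distrib sum_dir_deriv_flux[OF u] sum_flux_log_grad[OF p]
  by (simp add: diff_op_BT_def case_prod_unfold sum.distrib algebra_simps)

text \<open>
  The bilinear form \<open>grad g \<cdot> M grad u\<close>.
\<close>
definition dirichlet_form where
  "dirichlet_form g u p = (\<Sum>k\<in>UNIV. dir_deriv (dirs k) g p * flux u k p)"

text \<open>
  This is the symmetry of the matrix \<open>M\<close>, seen after collecting its rank-one part into Euler operators.
\<close>
lemma dirichlet_form_commute: "dirichlet_form g u p = dirichlet_form u g p"
proof -
  have "dirichlet_form g u p = (1 - csum (snd p)) * (\<Sum>i\<in>UNIV. dx i g p * dx i u p)
      + (\<Sum>j\<in>UNIV. snd p $ j * (dy j g p * dy j u p)) - euler_op g p * euler_op u p" for g u
  proof -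
    have "dirichlet_form g u p =
        (\<Sum>i\<in>UNIV. (1 - csum (snd p)) * (dx i g p * dx i u p) - fst p $ i * dx i g p * euler_op u p)
        + (\<Sum>j\<in>UNIV. snd p $ j * (dy j g p * dy j u p) - snd p $ j * dy j g p * euler_op u p)"
      unfolding dirichlet_form_def sum_UNIV_Plus
      by (intro arg_cong2[where f = "(+)"] sum.cong refl) (simp_all add: dir_deriv_dirs flux_def algebra_simps)
    then show ?thesis
      by (simp add: euler_op_split[of g] sum_subtractf sum.distrib sum_distrib_left
          sum_distrib_right algebra_simps)
  qed
  then show ?thesis by (simp add: mult.commute)
qed

lemma real_polynomial_function_diff_op_BT:
  assumes "real_polynomial_function u"
  shows "real_polynomial_function (diff_op_BT \<mu> \<kappa> u)"
  unfolding diff_op_BT_def laplace_x_def funpow_2_apply case_prod_unfold prod.collapse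
  by (intro real_polynomial_function_closure assms) auto

lemma real_polynomial_function_dirichlet_form:
  assumes "real_polynomial_function g" "real_polynomial_function u"
  shows "real_polynomial_function (dirichlet_form g u)"
  unfolding dirichlet_form_def[abs_def]
  by (intro real_polynomial_function_closure assms real_polynomial_function_dir_deriv real_polynomial_function_flux) auto

text \<open>
  The divergence theorem for the field \<open>W g M grad u\<close>. Tangency is inherited from \<open>M grad u\<close>, since
  the factor \<open>g\<close> does not affect directions.
\<close>
lemma diff_op_BT_greens_identity:
  fixes \<kappa> :: "real^'n" and u g :: "(real^'m) \<times> (real^'n) \<Rightarrow> real"
  assumes \<mu>: "\<mu> > - 1/2" and \<kappa>: "\<And>j. \<kappa> $ j > -1"
    and u: "real_polynomial_function u" and g: "real_polynomial_function g"
  shows "(LINT p:ball_simplex|lborel. (g p * diff_op_BT \<mu> \<kappa> u p + dirichlet_form g u p) * weight_BT \<mu> \<kappa> p) = 0"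
proof (rule integral_weighted_divergence_eq_0[OF \<mu> \<kappa>, where f = "\<lambda>k p. g p * flux u k p"
      and c = "\<lambda>p. g p * ((\<Sum>j\<in>UNIV. dy j u p) - (real CARD('n) + 2) * euler_op u p)"])
  show "real_polynomial_function (\<lambda>p. g p * flux u k p)" for k
    by (intro real_polynomial_function_closure g real_polynomial_function_flux u)
  show "continuous_on UNIV (\<lambda>p. g p * diff_op_BT \<mu> \<kappa> u p + dirichlet_form g u p)"
    by (intro real_polynomial_function_continuous_on real_polynomial_function_closure g u
        real_polynomial_function_diff_op_BT real_polynomial_function_dirichlet_form)
  show "continuous_on UNIV (\<lambda>p. g p * ((\<Sum>j\<in>UNIV. dy j u p) - (real CARD('n) + 2) * euler_op u p))"
    by (intro real_polynomial_function_continuous_on real_polynomial_function_closure g u) auto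
  show "(\<Sum>k\<in>UNIV. dir_deriv (dirs k) (\<lambda>p. g p * flux u k p) p + g p * flux u k p * log_grad \<mu> \<kappa> k p) =
      g p * diff_op_BT \<mu> \<kappa> u p + dirichlet_form g u p"
    if "p \<in> ball_simplex_interior" for p
    unfolding diff_op_BT_eq_divergence[OF u that, symmetric] dirichlet_form_def
      dir_deriv_mult[OF g real_polynomial_function_flux[OF u]]
    by (simp add: sum.distrib sum_distrib_left algebra_simps)
  \<comment> \<open>The parameters \<open>3/2\<close> and \<open>1\<close> make all exponents in the weight equal to 1, giving the boundary function.\<close>
  show "(\<Sum>k\<in>UNIV. g p * flux u k p * log_grad (3/2) 1 k p) =
      g p * ((\<Sum>j\<in>UNIV. dy j u p) - (real CARD('n) + 2) * euler_op u p)"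
    if "p \<in> ball_simplex_interior" for p
  proof -
    have "csum (1 :: real^'n) = real CARD('n)" by (simp add: csum_def)
    then show ?thesis
      using sum_flux_log_grad[OF that, of u "3/2" 1]
      by (simp add: mult.assoc sum_distrib_left[symmetric])
  qed
qed

lemma diff_op_BT_symmetric:
  fixes \<kappa> :: "real^'n" and u g :: "(real^'m) \<times> (real^'n) \<Rightarrow> real"
  assumes \<mu>: "\<mu> > - 1/2" and \<kappa>: "\<And>j. \<kappa> $ j > -1"
    and u: "real_polynomial_function u" and g: "real_polynomial_function g"
  shows "(LINT p:ball_simplex|lborel. diff_op_BT \<mu> \<kappa> u p * g p * weight_BT \<mu> \<kappa> p) =
    (LINT p:ball_simplex|lborel. u p * diff_op_BT \<mu> \<kappa> g p * weight_BT \<mu> \<kappa> p)"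
proof -
  have int: "set_integrable lborel ball_simplex (\<lambda>p. f p * weight_BT \<mu> \<kappa> p)"
    if "real_polynomial_function f" for f :: "(real^'m) \<times> (real^'n) \<Rightarrow> real"
    using \<mu> \<kappa> real_polynomial_function_continuous_on[OF that] by (rule set_integrable_mult_weight_BT)
  have key: "(LINT p:ball_simplex|lborel. g p * diff_op_BT \<mu> \<kappa> u p * weight_BT \<mu> \<kappa> p) =
      - (LINT p:ball_simplex|lborel. dirichlet_form g u p * weight_BT \<mu> \<kappa> p)"
    if "real_polynomial_function u" "real_polynomial_function g"
    for u g :: "(real^'m) \<times> (real^'n) \<Rightarrow> real"
  proof -
    have "0 = (LINT p:ball_simplex|lborel. g p * diff_op_BT \<mu> \<kappa> u p * weight_BT \<mu> \<kappa> p
        + dirichlet_form g u p * weight_BT \<mu> \<kappa> p)"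
      using diff_op_BT_greens_identity[OF \<mu> \<kappa> that] by (simp add: distrib_right)
    also have "\<dots> = (LINT p:ball_simplex|lborel. g p * diff_op_BT \<mu> \<kappa> u p * weight_BT \<mu> \<kappa> p)
        + (LINT p:ball_simplex|lborel. dirichlet_form g u p * weight_BT \<mu> \<kappa> p)"
      by (intro set_integral_add int real_polynomial_function_closure that real_polynomial_function_diff_op_BT
          real_polynomial_function_dirichlet_form)
    finally show ?thesis by simp
  qed
  show ?thesis
    using key[OF u g] key[OF g u] by (simp add: dirichlet_form_commute[of g u] mult.commute)
qed

section \<open>Action on the leading part\<close>

lemma polys_upto_affine_mult_dir_deriv:
  fixes f l :: "'a::euclidean_space \<Rightarrow> real"
  assumes f: "f \<in> polys_upto n" and l: "l \<in> polys_upto 1"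
  shows "(\<lambda>p. l p * dir_deriv v f p) \<in> polys_upto n"
proof (cases n)
  case 0
  then have "dir_deriv v f = (\<lambda>_. 0)" using polys_upto_dir_deriv[OF f] by simp
  then show ?thesis by (simp add: polys_upto_const)
next
  case (Suc k)
  then have "dir_deriv v f \<in> polys_upto k" using polys_upto_dir_deriv[OF f] by simp
  from polys_upto_mult[OF l this] show ?thesis using Suc by simp
qed

lemma polys_upto_coordinates:
  "(\<lambda>p :: (real^'m) \<times> (real^'n). snd p $ j) \<in> polys_upto 1"
  "(\<lambda>p :: (real^'m) \<times> (real^'n). 1 - csum (snd p)) \<in> polys_upto 1"
proof -
  have "(\<lambda>p :: (real^'m) \<times> (real^'n). snd p $ j) = (\<lambda>p. p \<bullet> (0, axis j 1))" for j
    by (simp add: fun_eq_iff inner_axis)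
  then show y: "(\<lambda>p :: (real^'m) \<times> (real^'n). snd p $ j) \<in> polys_upto 1" for j
    using polys_upto_inner by metis
  show "(\<lambda>p :: (real^'m) \<times> (real^'n). 1 - csum (snd p)) \<in> polys_upto 1"
    unfolding csum_def by (intro polys_upto_diff polys_upto_const polys_upto_sum y finite)
qed

text \<open>
  The second-order terms other than the square of the Euler operator lose at least one degree.
  Modulo lower degree the Euler operator acts on polynomials of degree \<open>n\<close> as multiplication by
  \<open>n\<close>, so the remaining terms act as \<open>- n^2 - n A\<close>.
\<close>
lemma diff_op_BT_leading_part:
  fixes \<mu> :: real and \<kappa> :: "real^'n" and u :: "(real^'m) \<times> (real^'n) \<Rightarrow> real"
  defines "A \<equiv> csum \<kappa> + 2 * \<mu> + real CARD('m) + real CARD('n) - 1"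
  assumes u: "u \<in> polys_upto n"
  shows "(\<lambda>p. diff_op_BT \<mu> \<kappa> u p + real n * (real n + A) * u p) \<in> polys_upto (n - 1)"
proof -
  have eq: "diff_op_BT \<mu> \<kappa> u p + real n * (real n + A) * u p =
      (\<Sum>i\<in>UNIV. (1 - csum (snd p)) * dx i (dx i u) p)
      + (\<Sum>j\<in>UNIV. snd p $ j * dy j (dy j u) p + (\<kappa> $ j + 1) * dy j u p)
      - ((euler_op (euler_op u) p - real n * euler_op u p)
        + (real n + A) * (euler_op u p - real n * u p))" for p
    unfolding diff_op_BT_def A_def laplace_x_def funpow_2_apply case_prod_unfold prod.collapse
    by (simp add: sum_distrib_left algebra_simps)
  have d: "dx i u \<in> polys_upto (n - 1)" "dy j u \<in> polys_upto (n - 1)" for i j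
    using polys_upto_dir_deriv[OF u] by (auto simp: dx_def dy_def)
  have x: "(\<lambda>p. (1 - csum (snd p)) * dx i (dx i u) p) \<in> polys_upto (n - 1)" for i
    using polys_upto_affine_mult_dir_deriv[OF d(1) polys_upto_coordinates(2)]
    unfolding dx_def .
  have y: "(\<lambda>p. snd p $ j * dy j (dy j u) p) \<in> polys_upto (n - 1)" for j
    using polys_upto_affine_mult_dir_deriv[OF d(2) polys_upto_coordinates(1)]
    unfolding dy_def .
  show ?thesis
    unfolding eq
    by (rule polys_upto_diff[OF polys_upto_add[OF
          polys_upto_sum[OF finite x]
          polys_upto_sum[OF finite polys_upto_add[OF y polys_upto_cmult[OF d(2)]]]]
        polys_upto_add[OF
          polys_upto_euler_op(1)[OF polys_upto_euler_op(2)[OF u]]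
          polys_upto_cmult[OF polys_upto_euler_op(1)[OF u]]]])
qed

lemma diff_op_BT_const:
  fixes u :: "(real^'m) \<times> (real^'n) \<Rightarrow> real"
  assumes u: "u \<in> polys_upto 0"
  shows "diff_op_BT \<mu> \<kappa> u = (\<lambda>_. 0)"
proof -
  have du: "dx i u = (\<lambda>_. 0)" "dy j u = (\<lambda>_. 0)" for i j
    using polys_upto_dir_deriv[OF u] by (auto simp: dx_def dy_def)
  have d0: "dx i (\<lambda>_. 0) = (\<lambda>_. 0)" "dy j (\<lambda>_. 0) = (\<lambda>_ :: (real^'m) \<times> (real^'n). 0)" for i j
    by (simp_all add: dx_def dy_def dir_deriv_const)
  have E: "euler_op u = (\<lambda>_. 0)" "euler_op (\<lambda>_ :: (real^'m) \<times> (real^'n). 0) = (\<lambda>_. 0)"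
    by (rule ext, simp add: euler_op_split du d0)+
  show ?thesis
    by (rule ext) (simp add: diff_op_BT_def laplace_x_def funpow_2_apply case_prod_unfold du d0 E)
qed

section \<open>The eigenvalue equation\<close>

text \<open>
  The weight is positive on the interior, so the polynomial vanishes almost everywhere there. A
  nonempty open set has positive measure, hence it vanishes on the whole interior and is zero.
\<close>
lemma polynomial_eq_0_if_weighted_norm_eq_0:
  fixes \<kappa> :: "real^'n" and f :: "(real^'m) \<times> (real^'n) \<Rightarrow> real"
  assumes \<mu>: "\<mu> > - 1/2" and \<kappa>: "\<And>j. \<kappa> $ j > -1" and f: "real_polynomial_function f"
    and norm0: "(LINT p:ball_simplex|lborel. f p * f p * weight_BT \<mu> \<kappa> p) = 0"
  shows "f = (\<lambda>_. 0)"
proof -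
  let ?F = "\<lambda>p. indicator ball_simplex p * (f p * f p * weight_BT \<mu> \<kappa> p)"
  define S where "S = {p \<in> ball_simplex_interior. f p \<noteq> 0}"
  have "set_integrable lborel ball_simplex (\<lambda>p. f p * f p * weight_BT \<mu> \<kappa> p)"
    using \<mu> \<kappa> by (rule set_integrable_mult_weight_BT)
      (intro continuous_intros real_polynomial_function_continuous_on f)
  then have "AE p in lborel. ?F p = 0"
    using norm0 integral_nonneg_eq_0_iff_AE[of lborel ?F]
    by (simp add: set_integrable_def set_lebesgue_integral_def weight_BT_nonneg)
  then have "AE p in lborel. p \<notin> S"
  proof eventually_elim
    case (elim p)
    then show ?case
      using weight_BT_pos[of p \<mu> \<kappa>] ball_simplex_interior_subset
      by (auto simp: S_def indicator_def split: if_splits)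
  qed
  moreover have "open S"
  proof -
    have "open (f -` (- {0}))"
      by (intro open_vimage open_Compl closed_singleton real_polynomial_function_continuous_on f)
    then have "open (ball_simplex_interior \<inter> f -` (- {0}))"
      using open_ball_simplex_interior by (rule open_Int[rotated])
    moreover have "S = ball_simplex_interior \<inter> f -` (- {0})" by (auto simp: S_def)
    ultimately show ?thesis by simp
  qed
  ultimately have "S \<in> null_sets lborel"
    by (subst (asm) AE_iff_null_sets[symmetric]) (auto simp: borel_open)
  then have "negligible S"
    by (simp add: negligible_iff_null_sets null_sets_completionI)
  then have "S = {}" using \<open>open S\<close> open_not_negligible by blast
  then show ?thesis
    by (intro real_polynomial_function_eq_0_if_vanishes_on_open[OF f
          open_ball_simplex_interior ball_simplex_interior_nonempty]) (auto simp: S_def)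
qed

theorem theorem4p2:
  fixes \<mu> :: real and \<kappa> :: "real^'n" and n :: nat
    and u :: "(real^'m) \<times> (real^'n) \<Rightarrow> real"
  assumes "\<mu> > - 1/2"
    and "\<And>j. \<kappa> $ j > -1"
    and "u \<in> orth_polys ball_simplex (weight_BT \<mu> \<kappa>) n"
  shows "diff_op_BT \<mu> \<kappa> u = (\<lambda>p.
    - (real n * (real n + csum \<kappa> + 2 * \<mu> + real CARD('m) + real CARD('n) - 1)) * u p)"
proof -
  let ?W = "weight_BT \<mu> \<kappa> :: (real^'m) \<times> (real^'n) \<Rightarrow> real" and ?D = "diff_op_BT \<mu> \<kappa>"
  define A where "A = csum \<kappa> + 2 * \<mu> + real CARD('m) + real CARD('n) - 1"
  define v where "v = (\<lambda>p. ?D u p + real n * (real n + A) * u p)"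
  have u: "real_polynomial_function u"
    using assms(3) by (auto simp: orth_polys_def)
  have orth: "(LINT p:ball_simplex|lborel. u p * g p * ?W p) = 0"
      if "real_polynomial_function g" "total_degree g < n" for g
    using assms(3) that by (auto simp: orth_polys_def)
  have un: "u \<in> polys_upto n"
  proof (cases "u = (\<lambda>_. 0)")
    case True
    then show ?thesis by (simp add: polys_upto_const)
  next
    case False
    then have "total_degree u = n" using assms(3) by (auto simp: orth_polys_def)
    then show ?thesis using total_degree_le_iff[OF u, of n] by simp
  qed
  have "v = (\<lambda>_. 0)"
  \<comment> \<open>Degree 0 is separate because \<open>n - 1\<close> is truncated.\<close>
  proof (cases "n = 0")
    case True
    with un show ?thesis by (simp add: v_def diff_op_BT_const)
  next
    case False
    have low: "total_degree g < n" if "g \<in> polys_upto (n - 1)" for g :: "(real^'m) \<times> (real^'n) \<Rightarrow> real"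
      using that total_degree_le_iff[OF polys_upto_real_polynomial_function[OF that], of "n - 1"] False
      by linarith
    have v: "v \<in> polys_upto (n - 1)"
      unfolding v_def A_def by (rule diff_op_BT_leading_part) (rule un)
    define c where "c = real (n - 1) * (real (n - 1) + A)"
    have "(\<lambda>p. ?D v p + c * v p) \<in> polys_upto (n - 1)"
      unfolding c_def A_def using diff_op_BT_leading_part[OF v, of \<mu> \<kappa>]
      by (rule polys_upto_mono[rotated]) simp
    from polys_upto_diff[OF this polys_upto_cmult[OF v, of c]]
    have Dv: "?D v \<in> polys_upto (n - 1)" by simp
    note rv = polys_upto_real_polynomial_function[OF v]
    have int: "set_integrable lborel ball_simplex (\<lambda>p. f p * ?W p)"
      if "real_polynomial_function f" for f
      using assms(1,2) real_polynomial_function_continuous_on[OF that]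
      by (rule set_integrable_mult_weight_BT)
    \<comment> \<open>The defect \<open>v\<close> has lower degree, and so has its image under the operator; moving the operator across the inner product makes both orthogonal to \<open>u\<close>.\<close>
    have "(LINT p:ball_simplex|lborel. v p * v p * ?W p) =
        (LINT p:ball_simplex|lborel. ?D u p * v p * ?W p + real n * (real n + A) * (u p * v p * ?W p))"
      by (intro arg_cong[where f = "set_lebesgue_integral lborel ball_simplex"])
         (simp add: v_def fun_eq_iff algebra_simps)
    also have "\<dots> = (LINT p:ball_simplex|lborel. ?D u p * v p * ?W p)
        + real n * (real n + A) * (LINT p:ball_simplex|lborel. u p * v p * ?W p)"
    proof (subst set_integral_add)
      show "set_integrable lborel ball_simplex (\<lambda>p. ?D u p * v p * ?W p)"
        "set_integrable lborel ball_simplex (\<lambda>p. real n * (real n + A) * (u p * v p * ?W p))"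
        by (intro set_integrable_mult_right int real_polynomial_function_closure real_polynomial_function_diff_op_BT u rv)+
    qed simp
    also have "(LINT p:ball_simplex|lborel. u p * v p * ?W p) = 0"
      by (rule orth[OF rv low[OF v]])
    also have "(LINT p:ball_simplex|lborel. ?D u p * v p * ?W p) =
        (LINT p:ball_simplex|lborel. u p * ?D v p * ?W p)"
      by (rule diff_op_BT_symmetric[OF assms(1,2) u rv])
    also have "\<dots> = 0"
      by (rule orth[OF polys_upto_real_polynomial_function[OF Dv] low[OF Dv]])
    finally show ?thesis
      by (intro polynomial_eq_0_if_weighted_norm_eq_0[OF assms(1,2) rv]) simp
  qed
  then have "?D u p + real n * (real n + A) * u p = 0" for p
    by (metis v_def)
  then show ?thesis
    by (simp add: A_def fun_eq_iff eq_neg_iff_add_eq_0 algebra_simps)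
qed

end
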